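(* Let $G$ be a connected weighted undirected graph, let $\mathcal S\subseteq\mathbb{R}^{V(G)}$ be a $d$-dimensional vector space orthogonal to the all-ones vector $\mathbf{1}^{V(G)}$, and let $\epsilon\in(0,1)$. Then there exists an $(\mathcal S,\epsilon)$-spectral subspace sparsifier for $G$ with $O\!\left(\frac{d\log d}{\epsilon^2}\right)$ edges.
   Context: A weighted graph $G$ has positive edge weights $w_e$ and resistances $r_e=1/w_e$; its Laplacian is $L_G=B_G^TW_GB_G$, where $B_G$ is the signed edge–vertex incidence matrix and $W_G$ the diagonal matrix of weights; $L_G^+$ denotes the Moore–Penrose pseudoinverse. A reweighted minor $H$ of $G$ is a graph obtained from $G$ by deleting and contracting edges and then changing the (positive) weights of the remaining edges; it comes with a contraction map $\phi:V(G)\to V(H)$. Let $P\in\mathbb{R}^{V(H)\times V(G)}$ have $P_{uv}=1$ if $u=\phi(v)$ and $0$ otherwise, and for $x\in\mathbb{R}^{V(G)}$ set $x_H:=Px$. For a vector space $\mathcal S\subseteq\mathbb{R}^{V(G)}$ orthogonal to $\mathbf 1^{V(G)}$ and $\epsilon\in(0,1)$, a reweighted minor $H$ of $G$ is an $(\mathcal S,\epsilon)$-spectral subspace sparsifier if for all $x\in\mathcal S$: $(1-\epsilon)x^TL_G^+x\le x_H^TL_H^+x_H\le(1+\epsilon)x^TL_G^+x$. *)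

theory Defs
  imports Complex_Main "HOL-Library.Function_Algebras" "Graph_Theory.Graph_Theory"
begin

section \<open>Vectors and matrices with explicit index sets\<close>

text \<open>
  Vertex sets vary inside one statement (a graph and its minors, with bounds uniform in the number
  of vertices), so they are not types. A matrix in \<open>\<real>\<^bsup>I\<times>J\<^esup>\<close> is a function \<open>'i \<Rightarrow> 'j \<Rightarrow> real\<close> of which
  only the entries in \<open>I \<times> J\<close> are meaningful, and \<open>\<real>\<^bsup>V\<^esup>\<close> is the space of the functions that vanish
  outside \<open>V\<close>.
\<close>

definition fscale :: "real \<Rightarrow> ('v \<Rightarrow> real) \<Rightarrow> 'v \<Rightarrow> real" where
  "fscale c x = (\<lambda>v. c * x v)"

interpretation fvec: vector_space "fscale :: real \<Rightarrow> ('v \<Rightarrow> real) \<Rightarrow> 'v \<Rightarrow> real"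
  by unfold_locales (auto simp: fscale_def fun_eq_iff algebra_simps)

definition vecs :: "'v set \<Rightarrow> ('v \<Rightarrow> real) set" where
  "vecs V = {x. \<forall>v. v \<notin> V \<longrightarrow> x v = 0}"

definition inner_on :: "'v set \<Rightarrow> ('v \<Rightarrow> real) \<Rightarrow> ('v \<Rightarrow> real) \<Rightarrow> real" where
  "inner_on V x y = (\<Sum>v\<in>V. x v * y v)"

definition mat_vec :: "'j set \<Rightarrow> ('i \<Rightarrow> 'j \<Rightarrow> real) \<Rightarrow> ('j \<Rightarrow> real) \<Rightarrow> 'i \<Rightarrow> real" where
  "mat_vec J A x = (\<lambda>i. \<Sum>j\<in>J. A i j * x j)"

definition mat_mul ::
    "'k set \<Rightarrow> ('i \<Rightarrow> 'k \<Rightarrow> real) \<Rightarrow> ('k \<Rightarrow> 'j \<Rightarrow> real) \<Rightarrow> 'i \<Rightarrow> 'j \<Rightarrow> real" where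
  "mat_mul K A B = (\<lambda>i j. \<Sum>k\<in>K. A i k * B k j)"

definition mat_transpose :: "('i \<Rightarrow> 'j \<Rightarrow> real) \<Rightarrow> 'j \<Rightarrow> 'i \<Rightarrow> real" where
  "mat_transpose A = (\<lambda>j i. A i j)"

definition mat_diag :: "('i \<Rightarrow> real) \<Rightarrow> 'i \<Rightarrow> 'i \<Rightarrow> real" where
  "mat_diag d = (\<lambda>i j. if i = j then d i else 0)"

definition mat_eq :: "'i set \<Rightarrow> 'j set \<Rightarrow> ('i \<Rightarrow> 'j \<Rightarrow> real) \<Rightarrow> ('i \<Rightarrow> 'j \<Rightarrow> real) \<Rightarrow> bool" where
  "mat_eq I J A B \<longleftrightarrow> (\<forall>i\<in>I. \<forall>j\<in>J. A i j = B i j)"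

definition quad_form :: "'v set \<Rightarrow> ('v \<Rightarrow> 'v \<Rightarrow> real) \<Rightarrow> ('v \<Rightarrow> real) \<Rightarrow> real" where
  "quad_form V A x = inner_on V x (mat_vec V A x)"

text \<open>
  The four Penrose conditions for \<open>A \<in> \<real>\<^bsup>I\<times>J\<^esup>\<close>, \<open>X \<in> \<real>\<^bsup>J\<times>I\<^esup>\<close>. The last conjunct fixes the
  meaningless entries of \<open>X\<close>, so that for finite \<open>I\<close>, \<open>J\<close> there is exactly one such function.
\<close>

definition is_pinv ::
    "'i set \<Rightarrow> 'j set \<Rightarrow> ('i \<Rightarrow> 'j \<Rightarrow> real) \<Rightarrow> ('j \<Rightarrow> 'i \<Rightarrow> real) \<Rightarrow> bool" where
  "is_pinv I J A X \<longleftrightarrow>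
     mat_eq I J (mat_mul I (mat_mul J A X) A) A \<and>
     mat_eq J I (mat_mul J (mat_mul I X A) X) X \<and>
     mat_eq I I (mat_transpose (mat_mul J A X)) (mat_mul J A X) \<and>
     mat_eq J J (mat_transpose (mat_mul I X A)) (mat_mul I X A) \<and>
     (\<forall>j i. j \<notin> J \<or> i \<notin> I \<longrightarrow> X j i = 0)"

definition pinv :: "'i set \<Rightarrow> 'j set \<Rightarrow> ('i \<Rightarrow> 'j \<Rightarrow> real) \<Rightarrow> 'j \<Rightarrow> 'i \<Rightarrow> real" where
  "pinv I J A = (THE X. is_pinv I J A X)"


section \<open>Weighted graphs and Laplacians\<close>

text \<open>
  An undirected multigraph is represented by a digraph from the library: every arc is one undirected
  edge together with the arbitrary orientation that the signed incidence matrix needs anyway. Loops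
  and parallel edges are allowed because contraction creates them; a loop has a zero row in the
  incidence matrix. Connectedness is that of the underlying undirected graph.
\<close>

definition weighted_graph :: "('v, 'e) pre_digraph \<Rightarrow> 'e weight_fun \<Rightarrow> bool" where
  "weighted_graph G w \<longleftrightarrow> fin_digraph G \<and> (\<forall>e\<in>arcs G. 0 < w e)"

definition incidence :: "('v, 'e) pre_digraph \<Rightarrow> 'e \<Rightarrow> 'v \<Rightarrow> real" where
  "incidence G e v = of_bool (v = tail G e) - of_bool (v = head G e)"

definition laplacian :: "('v, 'e) pre_digraph \<Rightarrow> 'e weight_fun \<Rightarrow> 'v \<Rightarrow> 'v \<Rightarrow> real" where
  "laplacian G w =
     mat_mul (arcs G) (mat_mul (arcs G) (mat_transpose (incidence G)) (mat_diag w)) (incidence G)"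

definition laplacian_pinv :: "('v, 'e) pre_digraph \<Rightarrow> 'e weight_fun \<Rightarrow> 'v \<Rightarrow> 'v \<Rightarrow> real" where
  "laplacian_pinv G w = pinv (verts G) (verts G) (laplacian G w)"


section \<open>Reweighted minors and spectral subspace sparsifiers\<close>

text \<open>
  \<open>H\<close> is \<open>G / C - D\<close> with \<open>C\<close> the contracted and \<open>D\<close> the deleted edges: \<open>\<phi>\<close> identifies two
  vertices of \<open>G\<close> iff they are joined by a path of edges in \<open>C\<close>, and every remaining edge keeps its
  identity and is attached to the images of its end points. No vertices are removed. The weights of
  \<open>G\<close> play no role, since those of \<open>H\<close> are arbitrary positive numbers.
\<close>

definition reweighted_minor ::
    "('v, 'e) pre_digraph \<Rightarrow> ('u, 'e) pre_digraph \<Rightarrow> 'e weight_fun \<Rightarrow> ('v \<Rightarrow> 'u) \<Rightarrow> bool" where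
  "reweighted_minor G H wH \<phi> \<longleftrightarrow>
     (\<exists>C D. C \<subseteq> arcs G \<and> D \<subseteq> arcs G \<and> C \<inter> D = {} \<and>
        verts H = \<phi> ` verts G \<and>
        (\<forall>u\<in>verts G. \<forall>v\<in>verts G.
           \<phi> u = \<phi> v \<longleftrightarrow> u \<rightarrow>\<^sup>*\<^bsub>mk_symmetric (G\<lparr>arcs := C\<rparr>)\<^esub> v) \<and>
        arcs H = arcs G - C - D \<and>
        (\<forall>e\<in>arcs H. tail H e = \<phi> (tail G e) \<and> head H e = \<phi> (head G e))) \<and>
     (\<forall>e\<in>arcs H. 0 < wH e)"

text \<open>The matrix \<open>P\<close>, so that \<open>mat_vec (verts G) (contraction_mat \<phi>) x\<close> is \<open>x\<^sub>H\<close>.\<close>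

definition contraction_mat :: "('v \<Rightarrow> 'u) \<Rightarrow> 'u \<Rightarrow> 'v \<Rightarrow> real" where
  "contraction_mat \<phi> u v = (if u = \<phi> v then 1 else 0)"

definition spectral_subspace_sparsifier ::
    "('v, 'e) pre_digraph \<Rightarrow> 'e weight_fun \<Rightarrow> ('v \<Rightarrow> real) set \<Rightarrow> real \<Rightarrow>
     ('u, 'e) pre_digraph \<Rightarrow> 'e weight_fun \<Rightarrow> ('v \<Rightarrow> 'u) \<Rightarrow> bool" where
  "spectral_subspace_sparsifier G w S \<epsilon> H wH \<phi> \<longleftrightarrow>
     reweighted_minor G H wH \<phi> \<and>
     (\<forall>x\<in>S. let xH = mat_vec (verts G) (contraction_mat \<phi>) x in
        (1 - \<epsilon>) * quad_form (verts G) (laplacian_pinv G w) x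
          \<le> quad_form (verts H) (laplacian_pinv H wH) xH \<and>
        quad_form (verts H) (laplacian_pinv H wH) xH
          \<le> (1 + \<epsilon>) * quad_form (verts G) (laplacian_pinv G w) x)"

end

theory Submission
  imports Defs
begin

text \<open>
  For a minor \<open>H\<close> of \<open>G\<close> let \<open>M\<close> be the matrix of the form \<open>x\<^sub>H\<^sup>T L\<^sub>H\<^sup>+ x\<^sub>H\<close> in a basis of \<open>S\<close> that is
  orthonormal for \<open>x\<^sup>T L\<^sub>G\<^sup>+ x\<close>. It is a sum of rank one matrices \<open>v\<^sub>e v\<^sub>e\<^sup>T\<close>, one for each edge of \<open>H\<close>, and
  changing the conductance of \<open>e\<close> replaces \<open>M\<close> by \<open>M + \<delta> v\<^sub>e v\<^sub>e\<^sup>T\<close>. If the leverage score of \<open>e\<close> is at most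
  \<open>1/2\<close>, then deleting \<open>e\<close> and doubling its weight give coefficients \<open>\<delta>\<close> of opposite signs and of order
  one; otherwise contracting \<open>e\<close> and halving its weight do. So there is a random update with mean
  zero that removes \<open>e\<close> with constant probability.

  As in the sparsifiers of Batson, Spielman and Srivastava, the spectrum of \<open>M\<close> is kept between
  barriers \<open>l\<close> and \<open>u\<close> by bounding the potential \<open>tr (u - M)\<^sup>-\<^sup>1 + tr (M - l)\<^sup>-\<^sup>1\<close> by \<open>T = 4 d / \<epsilon>\<close>. As the first
  order terms cancel, the expected increase of the potential for a suitable one of \<open>m\<close> edges is
  paid for by moving the barriers by \<open>O(T / m\<^sup>2)\<close> whenever an edge is removed. These shifts add up to
  \<open>O(T / m)\<close> when \<open>m\<close> edges are left, which is less than \<open>\<epsilon> / 2\<close> until \<open>m = O(d / \<epsilon>\<^sup>2)\<close>.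
\<close>

section \<open>Positive definite matrices over a finite index set\<close>

text \<open>Independent sampling with a matrix concentration bound would cost the factor
  \<open>log d\<close>; the barrier potential avoids it, and the bound reached is
  \<open>3201 * d / \<epsilon>\<^sup>2\<close>. One operation alone would not do: deletion only
  raises the form, contraction only lowers it, and deleting an edge of leverage score near 1 or
  contracting one of score near 0 has an unbounded coefficient. Hence the case split at 1/2 and, for
  each removal, a reweighting of opposite sign as its partner. The random choice is only a guide:
  one of the two outcomes does at least as well as their weighted mean, and that one is taken. It
  may be the reweighting, which removes nothing, so each round must also gain a fixed amount of
  potential. The vectors \<open>v e\<close> depend on the current potentials and are recomputed in
  every round; only the matrix, the network and the barriers are carried over. Eigenvalues never
  occur: resolvents are given as inverses and followed through rank one updates, and spectral
  inequalities are reduced to Cauchy--Schwarz.\<close>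

lemma inner_on_commute: "inner_on I x y = inner_on I y x"
  by (simp add: inner_on_def mult.commute)

lemma inner_on_add_left: "inner_on I (\<lambda>i. x i + y i) z = inner_on I x z + inner_on I y z"
  by (simp add: inner_on_def sum.distrib algebra_simps)

lemma inner_on_diff_left: "inner_on I (\<lambda>i. x i - y i) z = inner_on I x z - inner_on I y z"
  by (simp add: inner_on_def sum_subtractf algebra_simps)

lemma inner_on_scale_left: "inner_on I (\<lambda>i. c * x i) z = c * inner_on I x z"
  by (simp add: inner_on_def sum_distrib_left algebra_simps)

lemma inner_on_add_right: "inner_on I z (\<lambda>i. x i + y i) = inner_on I z x + inner_on I z y"
  by (simp add: inner_on_def sum.distrib algebra_simps)

lemma inner_on_diff_right: "inner_on I z (\<lambda>i. x i - y i) = inner_on I z x - inner_on I z y"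
  by (simp add: inner_on_def sum_subtractf algebra_simps)

lemma inner_on_scale_right: "inner_on I z (\<lambda>i. c * x i) = c * inner_on I z x"
  by (simp add: inner_on_def sum_distrib_left algebra_simps)

lemmas inner_on_linear =
  inner_on_add_left inner_on_diff_left inner_on_scale_left
  inner_on_add_right inner_on_diff_right inner_on_scale_right

lemma inner_on_self_nonneg: "0 \<le> inner_on I x x"
  by (simp add: inner_on_def sum_nonneg)

lemma inner_on_cong:
  "(\<And>i. i \<in> I \<Longrightarrow> x i = x' i) \<Longrightarrow> (\<And>i. i \<in> I \<Longrightarrow> y i = y' i) \<Longrightarrow> inner_on I x y = inner_on I x' y'"
  by (simp add: inner_on_def)

lemma mat_vec_add: "mat_vec I A (\<lambda>i. x i + y i) i = mat_vec I A x i + mat_vec I A y i"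
  by (simp add: mat_vec_def sum.distrib algebra_simps)

lemma mat_vec_scale: "mat_vec I A (\<lambda>i. c * x i) i = c * mat_vec I A x i"
  by (simp add: mat_vec_def sum_distrib_left algebra_simps)

lemma mat_vec_cong:
  "(\<And>j. j \<in> I \<Longrightarrow> x j = x' j) \<Longrightarrow> mat_vec I A x = mat_vec I A x'"
  by (simp add: mat_vec_def)

section \<open>Symmetric and positive semidefinite forms\<close>

definition symmetric_on :: "'i set \<Rightarrow> ('i \<Rightarrow> 'i \<Rightarrow> real) \<Rightarrow> bool" where
  "symmetric_on I A \<longleftrightarrow> (\<forall>i\<in>I. \<forall>j\<in>I. A i j = A j i)"

lemma symmetric_onD: "symmetric_on I A \<Longrightarrow> i \<in> I \<Longrightarrow> j \<in> I \<Longrightarrow> A i j = A j i"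
  by (simp add: symmetric_on_def)

lemma inner_on_mat_vec: "inner_on I x (mat_vec I A y) = (\<Sum>i\<in>I. \<Sum>j\<in>I. A i j * x i * y j)"
  by (simp add: inner_on_def mat_vec_def sum_distrib_left algebra_simps)

lemma inner_on_mat_vec_symmetric:
  assumes "symmetric_on I A"
  shows "inner_on I x (mat_vec I A y) = inner_on I y (mat_vec I A x)"
  unfolding inner_on_mat_vec
  by (subst sum.swap, intro sum.cong refl) (simp add: symmetric_onD[OF assms])

definition psd_on :: "'i set \<Rightarrow> ('i \<Rightarrow> 'i \<Rightarrow> real) \<Rightarrow> bool" where
  "psd_on I A \<longleftrightarrow> symmetric_on I A \<and> (\<forall>x. 0 \<le> quad_form I A x)"

lemma quadratic_discriminant:
  fixes p q r :: real
  assumes "\<And>t. 0 \<le> p + 2 * t * q + t\<^sup>2 * r"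
  shows "q\<^sup>2 \<le> p * r"
proof (cases "r = 0")
  case True
  have "q = 0"
  proof (rule ccontr)
    assume "q \<noteq> 0"
    then show False using assms[of "- (p + 1) / (2 * q)"] True by (simp add: field_simps)
  qed
  then show ?thesis using True by simp
next
  case False
  have r: "r > 0"
  proof (rule ccontr)
    assume "\<not> r > 0"
    with False have r: "r < 0" by simp
    have "0 \<le> p" using assms[of 0] by simp
    \<comment> \<open>Adding the hypotheses for \<open>t\<close> and \<open>- t\<close> cancels the
      linear term; this \<open>t\<close> makes the sum equal to -2.\<close>
    define t where "t = sqrt ((p + 1) / - r)"
    have "t\<^sup>2 * r = - (p + 1)"
      using r \<open>0 \<le> p\<close> by (simp add: t_def divide_nonneg_neg real_sqrt_pow2 field_simps)
    moreover have "0 \<le> 2 * p + 2 * (t\<^sup>2 * r)" using assms[of t] assms[of "- t"] by simp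
    ultimately show False using \<open>0 \<le> p\<close> by simp
  qed
  show ?thesis using assms[of "- q / r"] r by (simp add: field_simps power2_eq_square)
qed

lemma psd_on_Cauchy_Schwarz:
  assumes "psd_on I A"
  shows "(inner_on I x (mat_vec I A y))\<^sup>2 \<le> quad_form I A x * quad_form I A y"
proof (rule quadratic_discriminant)
  fix t :: real
  have sym: "symmetric_on I A" using assms by (simp add: psd_on_def)
  have "mat_vec I A (\<lambda>i. x i + t * y i) = (\<lambda>i. mat_vec I A x i + t * mat_vec I A y i)"
    by (simp add: fun_eq_iff mat_vec_add mat_vec_scale)
  then have "quad_form I A (\<lambda>i. x i + t * y i) =
    quad_form I A x + 2 * t * inner_on I x (mat_vec I A y) + t\<^sup>2 * quad_form I A y"
    using inner_on_mat_vec_symmetric[OF sym, of x y]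
    by (simp add: quad_form_def inner_on_linear algebra_simps power2_eq_square)
  then show "0 \<le> quad_form I A x + 2 * t * inner_on I x (mat_vec I A y) + t\<^sup>2 * quad_form I A y"
    using assms unfolding psd_on_def by metis
qed

section \<open>Trace and Frobenius norm\<close>

definition trace_on :: "'i set \<Rightarrow> ('i \<Rightarrow> 'i \<Rightarrow> real) \<Rightarrow> real" where
  "trace_on I A = (\<Sum>i\<in>I. A i i)"

definition frobenius :: "'i set \<Rightarrow> ('i \<Rightarrow> 'i \<Rightarrow> real) \<Rightarrow> real" where
  "frobenius I A = (\<Sum>i\<in>I. \<Sum>j\<in>I. (A i j)\<^sup>2)"

lemma frobenius_nonneg: "0 \<le> frobenius I A"
  by (simp add: frobenius_def sum_nonneg)

lemma sum_Cauchy_Schwarz: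
  fixes a b :: "'k \<Rightarrow> real"
  shows "(\<Sum>k\<in>K. a k * b k)\<^sup>2 \<le> (\<Sum>k\<in>K. (a k)\<^sup>2) * (\<Sum>k\<in>K. (b k)\<^sup>2)"
proof (rule quadratic_discriminant)
  fix t :: real
  have "0 \<le> (\<Sum>k\<in>K. (a k + t * b k)\<^sup>2)" by (intro sum_nonneg) simp
  also have "\<dots> = (\<Sum>k\<in>K. (a k)\<^sup>2) + 2 * t * (\<Sum>k\<in>K. a k * b k) + t\<^sup>2 * (\<Sum>k\<in>K. (b k)\<^sup>2)"
    by (simp add: power2_eq_square algebra_simps sum.distrib sum_distrib_left)
  finally show "0 \<le> (\<Sum>k\<in>K. (a k)\<^sup>2) + 2 * t * (\<Sum>k\<in>K. a k * b k) + t\<^sup>2 * (\<Sum>k\<in>K. (b k)\<^sup>2)" .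
qed

text \<open>Cauchy--Schwarz over index pairs, \<open>B\<close> against the products
  \<open>x i * x j\<close>: the operator norm is at most the Frobenius norm, of which
  \<open>frobenius\<close> is the square.\<close>

lemma quad_form_frobenius_bound:
  "(quad_form I B x)\<^sup>2 \<le> frobenius I B * (inner_on I x x)\<^sup>2"
proof -
  have "quad_form I B x = (\<Sum>(i,j)\<in>I \<times> I. B i j * (x i * x j))"
    by (simp add: quad_form_def inner_on_mat_vec sum.cartesian_product mult.assoc)
  then have "(quad_form I B x)\<^sup>2 \<le> (\<Sum>(i,j)\<in>I \<times> I. (B i j)\<^sup>2) * (\<Sum>(i,j)\<in>I \<times> I. (x i * x j)\<^sup>2)"
    using sum_Cauchy_Schwarz[of "\<lambda>(i,j). B i j" "\<lambda>(i,j). x i * x j" "I \<times> I"]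
    by (simp add: case_prod_unfold)
  also have "(\<Sum>(i,j)\<in>I \<times> I. (x i * x j)\<^sup>2) = (inner_on I x x)\<^sup>2"
    by (simp add: inner_on_def sum.cartesian_product[symmetric] power2_eq_square sum_product mult_ac)
  also have "(\<Sum>(i,j)\<in>I \<times> I. (B i j)\<^sup>2) = frobenius I B"
    by (simp add: frobenius_def sum.cartesian_product)
  finally show ?thesis .
qed

text \<open>Positive definiteness is witnessed by an inverse: a semidefinite \<open>A\<close> with a
  right inverse has no kernel. Carrying \<open>X\<close> along replaces eigenvalues, and the barrier
  potentials are traces of such witnesses.\<close>

definition posdef_inverse :: "'i set \<Rightarrow> ('i \<Rightarrow> 'i \<Rightarrow> real) \<Rightarrow> ('i \<Rightarrow> 'i \<Rightarrow> real) \<Rightarrow> bool" where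
  "posdef_inverse I A X \<longleftrightarrow> finite I \<and> psd_on I A \<and> symmetric_on I X \<and>
     (\<forall>i\<in>I. \<forall>j\<in>I. (\<Sum>k\<in>I. A i k * X k j) = of_bool (i = j))"

context
  fixes I :: "'i set" and A X :: "'i \<Rightarrow> 'i \<Rightarrow> real"
  assumes inv: "posdef_inverse I A X"
begin

lemma posdef_inverse_finite: "finite I" and posdef_inverse_psd: "psd_on I A" and posdef_inverse_symmetric: "symmetric_on I A"
  and posdef_inverse_symmetric': "symmetric_on I X"
  using inv by (auto simp: posdef_inverse_def psd_on_def)

lemma posdef_inverse_mult: "i \<in> I \<Longrightarrow> j \<in> I \<Longrightarrow> (\<Sum>k\<in>I. A i k * X k j) = of_bool (i = j)"
  using inv by (simp add: posdef_inverse_def)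

lemma posdef_inverse_mult':
  assumes "i \<in> I" "j \<in> I" shows "(\<Sum>k\<in>I. X i k * A k j) = of_bool (i = j)"
proof -
  have "(\<Sum>k\<in>I. X i k * A k j) = (\<Sum>k\<in>I. A j k * X k i)"
    using assms symmetric_onD[OF posdef_inverse_symmetric] symmetric_onD[OF posdef_inverse_symmetric']
    by (intro sum.cong refl) (auto simp: mult.commute)
  then show ?thesis using posdef_inverse_mult[OF assms(2,1)] by auto
qed

lemma mat_vec_inverse:
  assumes "i \<in> I" shows "mat_vec I A (mat_vec I X v) i = v i"
proof -
  have "mat_vec I A (mat_vec I X v) i = (\<Sum>j\<in>I. \<Sum>k\<in>I. A i j * X j k * v k)"
    by (simp add: mat_vec_def sum_distrib_left mult.assoc)
  also have "\<dots> = (\<Sum>k\<in>I. (\<Sum>j\<in>I. A i j * X j k) * v k)"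
    by (subst sum.swap) (simp add: sum_distrib_right)
  also have "\<dots> = (\<Sum>k\<in>I. if i = k then v k else 0)"
    using assms by (intro sum.cong refl) (simp add: posdef_inverse_mult)
  finally show ?thesis using assms posdef_inverse_finite by simp
qed

lemma quad_form_inverse: "quad_form I X v = quad_form I A (mat_vec I X v)"
proof -
  have "inner_on I (mat_vec I X v) (mat_vec I A (mat_vec I X v)) = inner_on I (mat_vec I X v) v"
    by (intro inner_on_cong) (simp_all add: mat_vec_inverse)
  then show ?thesis by (simp add: quad_form_def inner_on_commute)
qed

lemma posdef_inverse_psd': "psd_on I X"
  using posdef_inverse_psd posdef_inverse_symmetric' by (simp add: psd_on_def quad_form_inverse)

text \<open>Since \<open>v\<close> is \<open>A\<close> applied to \<open>X v\<close>, this is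
  Cauchy--Schwarz in the form of \<open>A\<close>. The estimates for powers of \<open>X\<close>
  below rest on it.\<close>

lemma inverse_Cauchy_Schwarz: "(inner_on I v y)\<^sup>2 \<le> quad_form I X v * quad_form I A y"
proof -
  have "inner_on I v y = inner_on I y (mat_vec I A (mat_vec I X v))"
    unfolding inner_on_commute[of I v] by (intro inner_on_cong) (simp_all add: mat_vec_inverse)
  also have "\<dots> = inner_on I (mat_vec I X v) (mat_vec I A y)"
    by (rule inner_on_mat_vec_symmetric[OF posdef_inverse_symmetric])
  finally show ?thesis
    using psd_on_Cauchy_Schwarz[OF posdef_inverse_psd, of "mat_vec I X v" y] by (simp add: quad_form_inverse)
qed

text \<open>Sherman--Morrison\<close>

lemma posdef_inverse_rank_one:
  fixes \<delta> :: real and v :: "'i \<Rightarrow> real"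
  defines "z \<equiv> mat_vec I X v"
  defines "c \<equiv> \<delta> / (1 + \<delta> * quad_form I X v)"
  assumes pos: "1 + \<delta> * quad_form I X v > 0"
  shows "posdef_inverse I (\<lambda>i j. A i j + \<delta> * v i * v j) (\<lambda>i j. X i j - c * z i * z j)"
proof -
  let ?\<tau> = "quad_form I X v"
  have "0 \<le> quad_form I (\<lambda>i j. A i j + \<delta> * v i * v j) x" for x
  proof -
    have "quad_form I (\<lambda>i j. A i j + \<delta> * v i * v j) x = quad_form I A x + \<delta> * (inner_on I v x)\<^sup>2"
      unfolding quad_form_def inner_on_mat_vec
      by (simp add: inner_on_def algebra_simps sum.distrib power2_eq_square sum_product sum_distrib_left)
    moreover have "0 \<le> quad_form I A x + \<delta> * (inner_on I v x)\<^sup>2"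
    proof (cases "\<delta> \<ge> 0")
      case True
      then show ?thesis using posdef_inverse_psd by (simp add: psd_on_def)
    next
      case False
      \<comment> \<open>A negative update costs at most the fraction
        \<open>- \<delta> * ?\<tau>\<close> of the form of \<open>A\<close>, and \<open>pos\<close>
        says that this fraction is below 1.\<close>
      then have "\<delta> * (inner_on I v x)\<^sup>2 \<ge> \<delta> * (?\<tau> * quad_form I A x)"
        using inverse_Cauchy_Schwarz[of v x] by (intro mult_left_mono_neg) auto
      then have "quad_form I A x + \<delta> * (inner_on I v x)\<^sup>2 \<ge> (1 + \<delta> * ?\<tau>) * quad_form I A x"
        by (simp add: algebra_simps)
      moreover have "(1 + \<delta> * ?\<tau>) * quad_form I A x \<ge> 0"
        using pos posdef_inverse_psd by (simp add: psd_on_def)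
      ultimately show ?thesis by simp
    qed
    ultimately show ?thesis by simp
  qed
  moreover have "(\<Sum>k\<in>I. (A i k + \<delta> * v i * v k) * (X k j - c * z k * z j)) = of_bool (i = j)"
    if "i \<in> I" "j \<in> I" for i j
  proof -
    have "(\<Sum>k\<in>I. (A i k + \<delta> * v i * v k) * (X k j - c * z k * z j)) =
       (\<Sum>k\<in>I. A i k * X k j) - c * (\<Sum>k\<in>I. A i k * z k) * z j
       + \<delta> * v i * (\<Sum>k\<in>I. v k * X k j) - \<delta> * v i * c * (\<Sum>k\<in>I. v k * z k) * z j"
      by (simp add: algebra_simps sum.distrib sum_subtractf sum_distrib_left)
    also have "(\<Sum>k\<in>I. A i k * z k) = v i"
      using mat_vec_inverse[OF that(1), of v] by (simp add: z_def mat_vec_def)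
    also have "(\<Sum>k\<in>I. v k * X k j) = z j"
      using that symmetric_onD[OF posdef_inverse_symmetric'] unfolding z_def mat_vec_def
      by (intro sum.cong refl) (auto simp: mult.commute)
    also have "(\<Sum>k\<in>I. v k * z k) = ?\<tau>"
      by (simp add: quad_form_def inner_on_def z_def)
    also have "(\<Sum>k\<in>I. A i k * X k j) - c * v i * z j + \<delta> * v i * z j - \<delta> * v i * c * ?\<tau> * z j
      = of_bool (i = j) + v i * z j * (\<delta> - c * (1 + \<delta> * ?\<tau>))"
      using that by (simp add: posdef_inverse_mult algebra_simps)
    also have "c * (1 + \<delta> * ?\<tau>) = \<delta>" using pos by (simp add: c_def)
    finally show ?thesis by simp
  qed
  ultimately show ?thesis
    using posdef_inverse_finite symmetric_onD[OF posdef_inverse_symmetric] symmetric_onD[OF posdef_inverse_symmetric']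
    unfolding posdef_inverse_def psd_on_def symmetric_on_def by (auto simp: mult_ac)
qed

lemma quad_form_inverse_nonneg: "0 \<le> quad_form I X v"
  using posdef_inverse_psd' by (simp add: psd_on_def)

lemma inverse_diag_nonneg:
  assumes "i \<in> I" shows "0 \<le> X i i"
proof -
  have "quad_form I X (\<lambda>j. of_bool (j = i)) = X i i"
    using assms posdef_inverse_finite
    by (simp add: quad_form_def inner_on_mat_vec of_bool_def if_distrib[of "\<lambda>a. _ * a"] cong: if_cong)
  then show ?thesis using quad_form_inverse_nonneg by metis
qed

lemma trace_inverse_nonneg: "0 \<le> trace_on I X"
  unfolding trace_on_def by (intro sum_nonneg inverse_diag_nonneg)

text \<open>In terms of powers, v^T X^3 v <= (v^T X v) tr X^2. With \<open>?a\<close> the left side,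
  the square of v^T X^2 v is at most \<open>?\<tau> * ?a\<close>, and the Frobenius bound makes the
  square of \<open>?a\<close> at most tr X^2 times that; one factor \<open>?a\<close>
  cancels.\<close>

lemma inverse_cube_bound:
  fixes v defines "z \<equiv> mat_vec I X v"
  shows "quad_form I X z \<le> quad_form I X v * frobenius I X"
proof -
  let ?a = "quad_form I X z" and ?\<tau> = "quad_form I X v"
  have a: "0 \<le> ?a" by (rule quad_form_inverse_nonneg)
  have "inner_on I v (mat_vec I X z) = inner_on I z z"
    using inner_on_mat_vec_symmetric[OF posdef_inverse_symmetric', of v z] by (simp add: z_def)
  then have "(inner_on I z z)\<^sup>2 \<le> ?\<tau> * ?a"
    using inverse_Cauchy_Schwarz[of v "mat_vec I X z"] by (simp add: quad_form_inverse[symmetric])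
  then have "frobenius I X * (inner_on I z z)\<^sup>2 \<le> frobenius I X * (?\<tau> * ?a)"
    by (intro mult_left_mono frobenius_nonneg)
  then have "?a * ?a \<le> (?\<tau> * frobenius I X) * ?a"
    using quad_form_frobenius_bound[of I X z] by (simp add: power2_eq_square algebra_simps)
  then show ?thesis
    using a quad_form_inverse_nonneg[of v] frobenius_nonneg[of I X]
    by (cases "?a = 0") (auto dest: mult_right_le_imp_le)
qed

text \<open>That is v^T X^2 v <= (v^T X v) tr X. Coordinate \<open>i\<close> of \<open>z\<close>
  pairs \<open>v\<close> with column \<open>i\<close> of \<open>X\<close>, whose energy in the form
  of \<open>A\<close> is the diagonal entry \<open>X i i\<close>.\<close>

lemma norm_inverse_bound:
  fixes v defines "z \<equiv> mat_vec I X v"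
  shows "inner_on I z z \<le> quad_form I X v * trace_on I X"
proof -
  have "(z i)\<^sup>2 \<le> quad_form I X v * X i i" if i: "i \<in> I" for i
  proof -
    let ?x = "\<lambda>j. X j i"
    have "z i = inner_on I v ?x"
      unfolding z_def mat_vec_def inner_on_def using i
      by (intro sum.cong refl) (auto simp: mult.commute symmetric_onD[OF posdef_inverse_symmetric' i])
    moreover have "quad_form I A ?x = X i i"
    proof -
      have "quad_form I A ?x = inner_on I ?x (\<lambda>j. of_bool (j = i))"
        unfolding quad_form_def using i
        by (intro inner_on_cong) (auto simp: mat_vec_def posdef_inverse_mult)
      then show ?thesis using i posdef_inverse_finite
        by (simp add: inner_on_def of_bool_def if_distrib cong: if_cong)
    qed
    ultimately show ?thesis using inverse_Cauchy_Schwarz[of v ?x] by simp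
  qed
  then have "(\<Sum>i\<in>I. (z i)\<^sup>2) \<le> (\<Sum>i\<in>I. quad_form I X v * X i i)"
    by (rule sum_mono)
  then show ?thesis
    by (simp add: inner_on_def power2_eq_square trace_on_def sum_distrib_left)
qed

end

section \<open>Rank one and diagonal changes of the inverse\<close>

lemma trace_rank_one:
  "trace_on I (\<lambda>i j. X i j - c * z i * z j) = trace_on I X - c * inner_on I z z"
  by (simp add: trace_on_def inner_on_def sum_subtractf sum_distrib_left mult_ac)

lemma frobenius_rank_one:
  "frobenius I (\<lambda>i j. X i j - c * z i * z j) =
     frobenius I X - 2 * c * quad_form I X z + c\<^sup>2 * (inner_on I z z)\<^sup>2"
proof -
  have "frobenius I (\<lambda>i j. X i j - c * z i * z j) =
    (\<Sum>i\<in>I. \<Sum>j\<in>I. (X i j)\<^sup>2 - 2 * c * (X i j * z i * z j) + c\<^sup>2 * ((z i * z i) * (z j * z j)))"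
    unfolding frobenius_def
    by (intro sum.cong refl) (simp add: power2_eq_square algebra_simps)
  then show ?thesis
    unfolding quad_form_def inner_on_mat_vec frobenius_def unfolding inner_on_def
    by (simp add: sum.distrib sum_subtractf sum_distrib_left[symmetric] sum_distrib_right[symmetric]
        power2_eq_square del: mult_cancel_left)
qed

lemma posdef_inverse_cong:
  assumes "posdef_inverse I A X" "\<And>i j. i \<in> I \<Longrightarrow> j \<in> I \<Longrightarrow> A i j = A' i j"
  shows "posdef_inverse I A' X"
proof -
  have "quad_form I A' x = quad_form I A x" for x
    by (simp add: quad_form_def inner_on_mat_vec assms(2))
  moreover have "(\<Sum>k\<in>I. A' i k * X k j) = (\<Sum>k\<in>I. A i k * X k j)" if "i \<in> I" for i j
    using that assms(2) by simp
  ultimately show ?thesis using assms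
    unfolding posdef_inverse_def psd_on_def symmetric_on_def by auto
qed

text \<open>One diagonal entry is raised at a time, each a Sherman--Morrison step with a unit
  vector, so the new inverse exists and its trace does not grow. The subset \<open>J\<close> is
  there for this induction.\<close>

lemma posdef_inverse_diagonal_shift:
  assumes "posdef_inverse I A X" "s \<ge> 0" "J \<subseteq> I"
  shows "\<exists>X'. posdef_inverse I (\<lambda>i j. A i j + (if i = j \<and> i \<in> J then s else 0)) X' \<and>
    trace_on I X' \<le> trace_on I X"
proof -
  have "finite J" using assms posdef_inverse_finite finite_subset by metis
  then show ?thesis using \<open>J \<subseteq> I\<close>
  proof (induction J rule: finite_induct)
    case empty
    then show ?case using assms(1) by auto
  next
    case (insert k J)
    then obtain X' where X': "posdef_inverse I (\<lambda>i j. A i j + (if i = j \<and> i \<in> J then s else 0)) X'"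
      "trace_on I X' \<le> trace_on I X" by auto
    let ?v = "\<lambda>i. of_bool (i = k) :: real"
    let ?\<tau> = "quad_form I X' ?v"
    have \<tau>: "0 \<le> ?\<tau>" by (rule quad_form_inverse_nonneg[OF X'(1)])
    then have pos: "1 + s * ?\<tau> > 0" using assms(2) by (simp add: add_pos_nonneg)
    let ?c = "s / (1 + s * ?\<tau>)" and ?z = "mat_vec I X' ?v"
    have "posdef_inverse I (\<lambda>i j. A i j + (if i = j \<and> i \<in> insert k J then s else 0))
      (\<lambda>i j. X' i j - ?c * ?z i * ?z j)"
      by (rule posdef_inverse_cong[OF posdef_inverse_rank_one[OF X'(1) pos]])
        (use insert.hyps in \<open>auto simp: of_bool_def\<close>)
    moreover have "trace_on I (\<lambda>i j. X' i j - ?c * ?z i * ?z j) \<le> trace_on I X"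
    proof -
      have "0 \<le> ?c * inner_on I ?z ?z"
        using pos assms(2) inner_on_self_nonneg by (intro mult_nonneg_nonneg divide_nonneg_pos)
      then show ?thesis using X'(2) unfolding trace_rank_one by linarith
    qed
    ultimately show ?case by blast
  qed
qed

text \<open>The second order expansion \<open>X' = X - s X\<^sup>2 + s\<^sup>2 X X' X\<close> of the resolvent.\<close>

lemma posdef_inverse_shift:
  assumes inv: "posdef_inverse I A X" and s: "s \<ge> 0" "4 * s * trace_on I X \<le> 1"
  shows "\<exists>X'. posdef_inverse I (\<lambda>i j. A i j + (if i = j then s else 0)) X' \<and>
    trace_on I X' \<le> trace_on I X - 3 / 4 * s * frobenius I X"
proof -
  let ?A = "\<lambda>i j. A i j + (if i = j then s else 0)"
  have fin: "finite I" by (rule posdef_inverse_finite[OF inv])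
  obtain X' where "posdef_inverse I (\<lambda>i j. A i j + (if i = j \<and> i \<in> I then s else 0)) X'"
    and tr: "trace_on I X' \<le> trace_on I X"
    using posdef_inverse_diagonal_shift[OF inv s(1), of I] by auto
  from this(1) have inv': "posdef_inverse I ?A X'" by (rule posdef_inverse_cong) auto
  \<comment> \<open>Resolvent identity \<open>X = X' + s * X' X\<close>, from evaluating X' (A + s)
    X in two ways.\<close>
  have res: "X i j = X' i j + s * (\<Sum>k\<in>I. X' i k * X k j)" if ij: "i \<in> I" "j \<in> I" for i j
  proof -
    have "X i j = (\<Sum>l\<in>I. (\<Sum>k\<in>I. X' i k * ?A k l) * X l j)"
      using ij fin posdef_inverse_mult'[OF inv'] by (simp add: of_bool_def if_distrib[of "\<lambda>a. a * _"] cong: if_cong)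
    also have "\<dots> = (\<Sum>k\<in>I. X' i k * (\<Sum>l\<in>I. ?A k l * X l j))"
      unfolding sum_distrib_left sum_distrib_right by (subst sum.swap) (simp add: mult.assoc)
    also have "\<dots> = (\<Sum>k\<in>I. X' i k * (of_bool (k = j) + s * X k j))"
    proof (intro sum.cong refl arg_cong2[where f = "(*)"])
      fix k assume k: "k \<in> I"
      have "(\<Sum>l\<in>I. ?A k l * X l j) = (\<Sum>l\<in>I. A k l * X l j) + (\<Sum>l\<in>I. if k = l then s * X l j else 0)"
        by (simp add: sum.distrib[symmetric] distrib_right if_distrib[of "\<lambda>a. a * _"] cong: if_cong)
      then show "(\<Sum>l\<in>I. ?A k l * X l j) = of_bool (k = j) + s * X k j"
        using k ij fin by (simp add: posdef_inverse_mult[OF inv])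
    qed
    also have "\<dots> = X' i j + s * (\<Sum>k\<in>I. X' i k * X k j)"
      using ij fin by (simp add: algebra_simps sum.distrib sum_distrib_left of_bool_def
          if_distrib[of "\<lambda>a. _ * a"] cong: if_cong)
    finally show ?thesis .
  qed
  \<comment> \<open>\<open>q\<close> is tr X X' X, the remainder after the resolvent identity has
    been applied twice.\<close>
  define q where "q = (\<Sum>i\<in>I. quad_form I X' (\<lambda>k. X k i))"
  have "X' i i = X i i - s * (\<Sum>k\<in>I. (X k i)\<^sup>2) + s\<^sup>2 * quad_form I X' (\<lambda>k. X k i)" if i: "i \<in> I" for i
  proof -
    have "X' i i = X i i - s * (\<Sum>k\<in>I. X' i k * X k i)" using res[OF i i] by simp
    also have "(\<Sum>k\<in>I. X' i k * X k i) = (\<Sum>k\<in>I. X' k i * X k i)"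
      using i by (intro sum.cong refl) (simp add: symmetric_onD[OF posdef_inverse_symmetric'[OF inv']])
    also have "\<dots> = (\<Sum>k\<in>I. (X k i - s * (\<Sum>l\<in>I. X' k l * X l i)) * X k i)"
      using i res by (intro sum.cong refl) simp
    also have "\<dots> = (\<Sum>k\<in>I. (X k i)\<^sup>2) - s * quad_form I X' (\<lambda>k. X k i)"
      by (simp add: quad_form_def inner_on_def mat_vec_def algebra_simps sum_subtractf
          sum_distrib_left power2_eq_square)
    finally show ?thesis by (simp add: algebra_simps power2_eq_square)
  qed
  then have "trace_on I X' = (\<Sum>i\<in>I. X i i - s * (\<Sum>k\<in>I. (X k i)\<^sup>2) + s\<^sup>2 * quad_form I X' (\<lambda>k. X k i))"
    by (simp add: trace_on_def)
  also have "\<dots> = trace_on I X - s * (\<Sum>i\<in>I. \<Sum>k\<in>I. (X k i)\<^sup>2) + s\<^sup>2 * q"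
    by (simp add: trace_on_def q_def sum.distrib sum_subtractf sum_distrib_left)
  also have "(\<Sum>i\<in>I. \<Sum>k\<in>I. (X k i)\<^sup>2) = frobenius I X"
    unfolding frobenius_def by (rule sum.swap)
  finally have trX': "trace_on I X' = trace_on I X - s * frobenius I X + s\<^sup>2 * q" .
  \<comment> \<open>The largest eigenvalue of \<open>X'\<close> is at most its trace.\<close>
  have "quad_form I X' (\<lambda>k. X k i) \<le> trace_on I X' * (\<Sum>k\<in>I. (X k i)\<^sup>2)" for i
  proof -
    let ?x = "\<lambda>k. X k i"
    let ?a = "quad_form I X' ?x" and ?n = "inner_on I ?x ?x"
    let ?z = "mat_vec I X' ?x"
    have a: "?a \<ge> 0" by (rule quad_form_inverse_nonneg[OF inv'])
    have "?a\<^sup>2 = (inner_on I ?x ?z)\<^sup>2" by (simp add: quad_form_def)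
    also have "\<dots> \<le> ?n * inner_on I ?z ?z"
      using sum_Cauchy_Schwarz[of ?x ?z I] by (simp add: inner_on_def power2_eq_square)
    also have "\<dots> \<le> ?n * (?a * trace_on I X')"
      by (intro mult_left_mono norm_inverse_bound[OF inv'] inner_on_self_nonneg)
    finally have "?a * ?a \<le> (trace_on I X' * ?n) * ?a" by (simp add: power2_eq_square algebra_simps)
    then have "?a \<le> trace_on I X' * ?n"
      using a trace_inverse_nonneg[OF inv'] inner_on_self_nonneg[of I ?x]
      by (cases "?a = 0") (auto dest: mult_right_le_imp_le)
    then show ?thesis by (simp add: inner_on_def power2_eq_square)
  qed
  then have "q \<le> (\<Sum>i\<in>I. trace_on I X' * (\<Sum>k\<in>I. (X k i)\<^sup>2))"
    unfolding q_def by (intro sum_mono)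
  also have "\<dots> = trace_on I X' * frobenius I X"
    unfolding frobenius_def sum.swap[of "\<lambda>i j. (X i j)\<^sup>2" I I]
    by (simp add: sum_distrib_left)
  also have "\<dots> \<le> trace_on I X * frobenius I X"
    by (intro mult_right_mono tr frobenius_nonneg)
  finally have "s * (s * q) \<le> s * (s * (trace_on I X * frobenius I X))"
    using s(1) by (intro mult_left_mono)
  \<comment> \<open>The smallness of \<open>s\<close> turns the remainder into a quarter of the
    linear term, hence the factor 3/4.\<close>
  moreover have "s * (4 * s * trace_on I X * frobenius I X) \<le> s * (1 * frobenius I X)"
    using s by (intro mult_left_mono mult_right_mono frobenius_nonneg)
  ultimately have "s\<^sup>2 * q \<le> 1 / 4 * s * frobenius I X" by (simp add: power2_eq_square)
  then show ?thesis using inv' trX' by (intro exI[of _ X']) simp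
qed

section \<open>Barriers\<close>

text \<open>Serves both barriers, with \<open>A\<close> the difference between \<open>M\<close> and
  the barrier; for the upper one the sign of \<delta> flips. Small leverage keeps the
  Sherman--Morrison denominator within 1/16 of 1, so the trace follows its first order term up to a
  second order error, and the shift still earns half of \<open>s * frobenius I X\<close>.\<close>

lemma barrier_step:
  fixes I :: "'i set" and v :: "'i \<Rightarrow> real"
  defines "n X \<equiv> inner_on I (mat_vec I X v) (mat_vec I X v)"
  assumes inv: "posdef_inverse I A X" and \<tau>: "quad_form I X v \<le> 1 / 32" and \<delta>: "\<bar>\<delta>\<bar> \<le> 2"
    and s: "s \<ge> 0" "8 * s * trace_on I X \<le> 1"
  shows "\<exists>X'. posdef_inverse I (\<lambda>i j. A i j + \<delta> * v i * v j + (if i = j then s else 0)) X' \<and>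
    trace_on I X' \<le> trace_on I X - \<delta> * n X + 16 / 15 * \<delta>\<^sup>2 * quad_form I X v * n X
      - s * frobenius I X / 2"
proof -
  let ?\<tau> = "quad_form I X v" and ?z = "mat_vec I X v" and ?F = "frobenius I X"
  have \<tau>0: "0 \<le> ?\<tau>" by (rule quad_form_inverse_nonneg[OF inv])
  have "\<bar>\<delta> * ?\<tau>\<bar> \<le> 2 * (1 / 32)" unfolding abs_mult using \<delta> \<tau> \<tau>0 by (intro mult_mono) auto
  then have den: "1 + \<delta> * ?\<tau> \<ge> 15 / 16" by simp
  then have pos: "1 + \<delta> * ?\<tau> > 0" by simp
  define c where "c = \<delta> / (1 + \<delta> * ?\<tau>)"
  let ?X = "\<lambda>i j. X i j - c * ?z i * ?z j"
  have inv1: "posdef_inverse I (\<lambda>i j. A i j + \<delta> * v i * v j) ?X"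
    unfolding c_def by (rule posdef_inverse_rank_one[OF inv pos])
  have n0: "0 \<le> n X" by (simp add: n_def inner_on_self_nonneg)
  have t0: "0 \<le> trace_on I X" by (rule trace_inverse_nonneg[OF inv])
  have nt: "n X \<le> ?\<tau> * trace_on I X" unfolding n_def by (rule norm_inverse_bound[OF inv])
  have tr1: "trace_on I ?X = trace_on I X - c * n X" by (simp add: trace_rank_one n_def)
  have "- c = - \<delta> + \<delta>\<^sup>2 * ?\<tau> / (1 + \<delta> * ?\<tau>)" using pos by (simp add: c_def field_simps power2_eq_square)
  also have "\<delta>\<^sup>2 * ?\<tau> / (1 + \<delta> * ?\<tau>) \<le> \<delta>\<^sup>2 * ?\<tau> / (15 / 16)"
    using den \<tau>0 by (intro divide_left_mono) auto
  finally have "- c \<le> - \<delta> + 16 / 15 * \<delta>\<^sup>2 * ?\<tau>" by simp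
  then have "- c * n X \<le> (- \<delta> + 16 / 15 * \<delta>\<^sup>2 * ?\<tau>) * n X" using n0 by (rule mult_right_mono)
  then have tr1': "trace_on I ?X \<le> trace_on I X - \<delta> * n X + 16 / 15 * \<delta>\<^sup>2 * ?\<tau> * n X"
    unfolding tr1 by (simp add: algebra_simps)
  have "\<bar>c\<bar> = \<bar>\<delta>\<bar> / (1 + \<delta> * ?\<tau>)" using pos by (simp add: c_def)
  also have "\<dots> \<le> 2 / (15 / 16)" using den \<delta> by (intro frac_le) auto
  finally have c: "\<bar>c\<bar> \<le> 32 / 15" by simp
  have c\<tau>: "\<bar>c\<bar> * ?\<tau> \<le> 32 / 15 * (1 / 32)" using c \<tau> \<tau>0 by (intro mult_mono) auto
  have "- c * n X \<le> \<bar>c\<bar> * (?\<tau> * trace_on I X)" using n0 nt by (intro mult_mono) auto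
  also have "\<dots> \<le> (32 / 15 * (1 / 32)) * trace_on I X"
    using mult_right_mono[OF c\<tau> t0] by (simp add: mult.assoc)
  \<comment> \<open>The rank one step at most doubles the trace, so the factor 8 in the hypothesis
    on \<open>s\<close> leaves the 4 that the shift requires.\<close>
  finally have "trace_on I ?X \<le> 2 * trace_on I X" unfolding tr1 using t0 by simp
  then have "4 * s * trace_on I ?X \<le> 4 * s * (2 * trace_on I X)" using s(1) by (intro mult_left_mono) auto
  then have s1: "4 * s * trace_on I ?X \<le> 1" using s(2) by simp
  have a: "0 \<le> quad_form I X ?z" "quad_form I X ?z \<le> ?\<tau> * ?F"
    using quad_form_inverse_nonneg[OF inv] inverse_cube_bound[OF inv] by auto
  have "c * quad_form I X ?z \<le> \<bar>c\<bar> * (?\<tau> * ?F)" using a by (intro mult_mono) auto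
  also have "\<dots> \<le> (32 / 15 * (1 / 32)) * ?F"
    using mult_right_mono[OF c\<tau> frobenius_nonneg] by (simp add: mult.assoc)
  \<comment> \<open>The loss is at most 2/15, and 3/4 of what remains is above 1/2.\<close>
  finally have "frobenius I ?X \<ge> 13 / 15 * ?F"
    unfolding frobenius_rank_one by (simp add: add_increasing2)
  then have "3 / 4 * s * frobenius I ?X \<ge> 3 / 4 * s * (13 / 15 * ?F)"
    using s(1) by (intro mult_left_mono) auto
  moreover have "s * ?F \<ge> 0" using s(1) frobenius_nonneg by (intro mult_nonneg_nonneg)
  ultimately have F: "3 / 4 * s * frobenius I ?X \<ge> s * ?F / 2" by (simp add: algebra_simps)
  show ?thesis using posdef_inverse_shift[OF inv1 s(1) s1] tr1' F by fastforce
qed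

section \<open>Two barriers around the spectrum\<close>

definition scalar_mat :: "real \<Rightarrow> 'i \<Rightarrow> 'i \<Rightarrow> real" where
  "scalar_mat c i j = (if i = j then c else 0)"

text \<open>Existence of both inverses says that the spectrum of \<open>M\<close> lies strictly
  between \<open>l\<close> and \<open>u\<close>; each trace is the sum of the reciprocal distances
  of the eigenvalues to the barrier.\<close>

definition within_barriers :: "'i set \<Rightarrow> ('i \<Rightarrow> 'i \<Rightarrow> real) \<Rightarrow> real \<Rightarrow> real \<Rightarrow> real \<Rightarrow> bool" where
  "within_barriers I M l u T \<longleftrightarrow>
     (\<exists>X Y. posdef_inverse I (\<lambda>i j. scalar_mat u i j - M i j) X \<and>
        posdef_inverse I (\<lambda>i j. M i j - scalar_mat l i j) Y \<and> trace_on I X + trace_on I Y \<le> T)"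

definition rank_one_update :: "('i \<Rightarrow> 'i \<Rightarrow> real) \<Rightarrow> real \<Rightarrow> ('i \<Rightarrow> real) \<Rightarrow> 'i \<Rightarrow> 'i \<Rightarrow> real" where
  "rank_one_update M \<delta> v = (\<lambda>i j. M i j + \<delta> * v i * v j)"

lemma quad_form_scalar_mat:
  assumes "finite I" shows "quad_form I (scalar_mat c) x = c * inner_on I x x"
  using assms unfolding quad_form_def inner_on_mat_vec
  by (simp add: scalar_mat_def inner_on_def if_distrib[of "\<lambda>a. a * _"] sum_distrib_left mult.assoc cong: if_cong)

lemma quad_form_diff:
  "quad_form I (\<lambda>i j. A i j - B i j) x = quad_form I A x - quad_form I B x"
  by (simp add: quad_form_def inner_on_mat_vec left_diff_distrib sum_subtractf)

lemma within_barriers_bounds: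
  assumes "within_barriers I M l u T"
  shows "l * inner_on I x x \<le> quad_form I M x" "quad_form I M x \<le> u * inner_on I x x"
proof -
  from assms obtain X Y where X: "posdef_inverse I (\<lambda>i j. scalar_mat u i j - M i j) X"
    and Y: "posdef_inverse I (\<lambda>i j. M i j - scalar_mat l i j) Y"
    by (auto simp: within_barriers_def)
  have "0 \<le> quad_form I (\<lambda>i j. scalar_mat u i j - M i j) x"
    using posdef_inverse_psd[OF X] by (simp add: psd_on_def)
  then show "quad_form I M x \<le> u * inner_on I x x"
    by (simp add: quad_form_diff quad_form_scalar_mat posdef_inverse_finite[OF X])
  have "0 \<le> quad_form I (\<lambda>i j. M i j - scalar_mat l i j) x"
    using posdef_inverse_psd[OF Y] by (simp add: psd_on_def)
  then show "l * inner_on I x x \<le> quad_form I M x"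
    by (simp add: quad_form_diff quad_form_scalar_mat posdef_inverse_finite[OF X])
qed

lemma within_barriers_mono: "within_barriers I M l u T \<Longrightarrow> T \<le> T' \<Longrightarrow> within_barriers I M l u T'"
  unfolding within_barriers_def by (meson order_trans)

lemma within_barriers_nonneg: "within_barriers I M l u T \<Longrightarrow> 0 \<le> T"
  unfolding within_barriers_def using trace_inverse_nonneg by (smt (verit))

lemma within_barriers_scalar:
  assumes fin: "finite I" and "l < c" "c < u"
  shows "within_barriers I (scalar_mat c) l u (card I / (u - c) + card I / (c - l))"
proof -
  have "posdef_inverse I (scalar_mat a) (scalar_mat (1 / a))" if "a > 0" for a
    using fin that inner_on_self_nonneg[of I]
    by (auto simp: posdef_inverse_def psd_on_def symmetric_on_def quad_form_scalar_mat zero_le_mult_iff)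
      (auto simp: scalar_mat_def if_distrib[of "\<lambda>a. a * _"] cong: if_cong)
  moreover have "(\<lambda>i j. scalar_mat a i j - scalar_mat b i j) = (scalar_mat (a - b) :: 'a \<Rightarrow> 'a \<Rightarrow> real)"
    for a b by (simp add: scalar_mat_def fun_eq_iff)
  moreover have "trace_on I (scalar_mat a) = card I * a" for a :: real
    by (simp add: trace_on_def scalar_mat_def)
  ultimately show ?thesis
    unfolding within_barriers_def using assms
    by - (rule exI[of _ "scalar_mat (1 / (u - c))"], rule exI[of _ "scalar_mat (1 / (c - l))"], simp)
qed

lemma sum_mult_scalar_mat: "finite I \<Longrightarrow> (\<Sum>i\<in>I. \<Sum>j\<in>I. A i j * scalar_mat c i j) = c * trace_on I A"
  by (simp add: scalar_mat_def trace_on_def if_distrib[of "\<lambda>a. _ * a"] sum_distrib_left mult.commute cong: if_cong)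

lemma sum_inverse_mult:
  assumes "posdef_inverse I A B" shows "(\<Sum>i\<in>I. \<Sum>j\<in>I. B i j * A i j) = card I"
proof -
  have "(\<Sum>j\<in>I. B i j * A i j) = 1" if "i \<in> I" for i
    using posdef_inverse_mult'[OF assms that that] that symmetric_onD[OF posdef_inverse_symmetric[OF assms] that] by simp
  then show ?thesis by simp
qed

section \<open>Averages over the vectors whose squares sum to \<open>M\<close>\<close>

context
  fixes I :: "'i set" and M X Y :: "'i \<Rightarrow> 'i \<Rightarrow> real" and l u :: real
    and E :: "'e set" and v :: "'e \<Rightarrow> 'i \<Rightarrow> real"
  assumes X: "posdef_inverse I (\<lambda>i j. scalar_mat u i j - M i j) X"
    and Y: "posdef_inverse I (\<lambda>i j. M i j - scalar_mat l i j) Y"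
    and M: "\<And>i j. i \<in> I \<Longrightarrow> j \<in> I \<Longrightarrow> M i j = (\<Sum>e\<in>E. v e i * v e j)"
    and lu: "l \<le> 2" "u \<le> 2"
begin

lemma sum_quad_form_frame:
  "(\<Sum>e\<in>E. quad_form I A (v e)) = (\<Sum>i\<in>I. \<Sum>j\<in>I. A i j * M i j)"
proof -
  have "(\<Sum>e\<in>E. quad_form I A (v e)) = (\<Sum>i\<in>I. \<Sum>j\<in>I. \<Sum>e\<in>E. A i j * v e i * v e j)"
    unfolding quad_form_def inner_on_mat_vec
    by (subst sum.swap, intro sum.cong refl, subst sum.swap) simp
  then show ?thesis by (simp add: M sum_distrib_left mult.assoc)
qed

text \<open>The sum is tr X M; write \<open>M\<close> as u - (u - M) and use that \<open>X\<close>
  is inverse to u - M.\<close>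

lemma sum_upper_leverage: "(\<Sum>e\<in>E. quad_form I X (v e)) = u * trace_on I X - card I"
proof -
  have "(\<Sum>i\<in>I. \<Sum>j\<in>I. X i j * M i j) = (\<Sum>i\<in>I. \<Sum>j\<in>I. X i j * scalar_mat u i j)
     - (\<Sum>i\<in>I. \<Sum>j\<in>I. X i j * (scalar_mat u i j - M i j))"
    by (simp add: right_diff_distrib sum_subtractf)
  then show ?thesis
    using sum_mult_scalar_mat posdef_inverse_finite[OF X] sum_inverse_mult[OF X] by (simp add: sum_quad_form_frame)
qed

lemma sum_lower_leverage: "(\<Sum>e\<in>E. quad_form I Y (v e)) = l * trace_on I Y + card I"
proof -
  have "(\<Sum>i\<in>I. \<Sum>j\<in>I. Y i j * M i j) = (\<Sum>i\<in>I. \<Sum>j\<in>I. Y i j * scalar_mat l i j)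
     + (\<Sum>i\<in>I. \<Sum>j\<in>I. Y i j * (M i j - scalar_mat l i j))"
    by (simp add: right_diff_distrib sum_subtractf)
  then show ?thesis
    using sum_mult_scalar_mat posdef_inverse_finite[OF X] sum_inverse_mult[OF Y] by (simp add: sum_quad_form_frame)
qed

text \<open>The sum is tr B M B^T, and \<open>M\<close> is at most 2 by the upper barrier.\<close>

lemma sum_norm_frame_le:
  "(\<Sum>e\<in>E. inner_on I (mat_vec I B (v e)) (mat_vec I B (v e))) \<le> 2 * frobenius I B"
proof -
  have "within_barriers I M l u (trace_on I X + trace_on I Y)"
    using X Y by (auto simp: within_barriers_def)
  note bnd = within_barriers_bounds(2)[OF this]
  have "(\<Sum>e\<in>E. inner_on I (mat_vec I B (v e)) (mat_vec I B (v e)))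
     = (\<Sum>i\<in>I. \<Sum>e\<in>E. (mat_vec I B (v e) i)\<^sup>2)"
    unfolding inner_on_def power2_eq_square by (rule sum.swap)
  also have "\<dots> = (\<Sum>i\<in>I. quad_form I M (B i))"
  proof (intro sum.cong refl)
    fix i assume "i \<in> I"
    have "(\<Sum>e\<in>E. (mat_vec I B (v e) i)\<^sup>2) = (\<Sum>e\<in>E. \<Sum>j\<in>I. \<Sum>k\<in>I. v e j * v e k * B i j * B i k)"
      by (simp add: mat_vec_def power2_eq_square sum_product mult_ac)
    also have "\<dots> = (\<Sum>j\<in>I. \<Sum>k\<in>I. \<Sum>e\<in>E. v e j * v e k * B i j * B i k)"
      by (subst sum.swap, intro sum.cong refl, subst sum.swap) simp
    finally show "(\<Sum>e\<in>E. (mat_vec I B (v e) i)\<^sup>2) = quad_form I M (B i)"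
      unfolding quad_form_def inner_on_mat_vec by (simp add: M sum_distrib_right)
  qed
  also have "\<dots> \<le> (\<Sum>i\<in>I. 2 * inner_on I (B i) (B i))"
    using bnd mult_right_mono[OF lu(2) inner_on_self_nonneg] by (intro sum_mono) (rule order_trans)
  finally show ?thesis
    by (simp add: frobenius_def inner_on_def power2_eq_square sum_distrib_left)
qed

text \<open>Nonnegative total leverage forces tr X >= card I / 2, and (X i i - 1/2)^2 >= 0 turns
  this into a bound on squares. It makes the gain of a round independent of
  \<open>M\<close>.\<close>

lemma frobenius_upper_ge: "frobenius I X \<ge> card I / 4"
proof -
  have "0 \<le> u * trace_on I X - card I"
    unfolding sum_upper_leverage[symmetric] by (intro sum_nonneg quad_form_inverse_nonneg[OF X])
  moreover have "u * trace_on I X \<le> 2 * trace_on I X"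
    using lu trace_inverse_nonneg[OF X] by (intro mult_right_mono)
  ultimately have t: "trace_on I X \<ge> card I / 2" by simp
  have "trace_on I X - card I / 4 = (\<Sum>i\<in>I. X i i - 1 / 4)"
    by (simp add: trace_on_def sum_subtractf)
  also have "\<dots> \<le> (\<Sum>i\<in>I. \<Sum>j\<in>I. (X i j)\<^sup>2)"
  proof (rule sum_mono)
    fix i assume i: "i \<in> I"
    have "0 \<le> (X i i - 1 / 2)\<^sup>2" by simp
    then have "X i i - 1 / 4 \<le> (X i i)\<^sup>2" by (simp add: power2_eq_square algebra_simps)
    also have "\<dots> \<le> (\<Sum>j\<in>I. (X i j)\<^sup>2)"
      using i posdef_inverse_finite[OF X] by (intro member_le_sum) auto
    finally show "X i i - 1 / 4 \<le> (\<Sum>j\<in>I. (X i j)\<^sup>2)" .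
  qed
  finally show ?thesis using t by (simp add: frobenius_def)
qed

text \<open>Both quantities average at most half of the stated bounds. If every vector violated one
  of them, the two ratios to the bounds, summed over \<open>E\<close>, would exceed
  \<open>card E\<close>, which they cannot.\<close>

lemma exists_cheap_vector:
  assumes T: "trace_on I X + trace_on I Y \<le> T" "0 < T" and E: "finite E" "E \<noteq> {}" and I: "I \<noteq> {}"
  defines "F \<equiv> frobenius I X + frobenius I Y"
  shows "\<exists>e\<in>E. quad_form I X (v e) + quad_form I Y (v e) \<le> 4 * T / card E \<and>
    inner_on I (mat_vec I X (v e)) (mat_vec I X (v e)) +
    inner_on I (mat_vec I Y (v e)) (mat_vec I Y (v e)) \<le> 4 * F / card E"
proof (rule ccontr)
  let ?m = "real (card E)"
  define p where "p e = quad_form I X (v e) + quad_form I Y (v e)" for e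
  define q where "q e = inner_on I (mat_vec I X (v e)) (mat_vec I X (v e)) +
    inner_on I (mat_vec I Y (v e)) (mat_vec I Y (v e))" for e
  assume "\<not> ?thesis"
  then have neg: "\<not> (p e \<le> 4 * T / ?m \<and> q e \<le> 4 * F / ?m)" if "e \<in> E" for e
    using that by (auto simp: p_def q_def)
  have m: "?m > 0" using E by (simp add: card_gt_0_iff)
  have "card I > 0" using I posdef_inverse_finite[OF X] by (simp add: card_gt_0_iff)
  then have F: "F > 0" using frobenius_upper_ge frobenius_nonneg[of I Y] by (simp add: F_def)
  have p0: "p e \<ge> 0" for e
    using quad_form_inverse_nonneg[OF X] quad_form_inverse_nonneg[OF Y] by (simp add: p_def)
  have q0: "q e \<ge> 0" for e by (simp add: q_def inner_on_self_nonneg)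
  have "(\<Sum>e\<in>E. p e) = u * trace_on I X + l * trace_on I Y"
    by (simp add: p_def sum.distrib sum_upper_leverage sum_lower_leverage)
  also have "\<dots> \<le> 2 * trace_on I X + 2 * trace_on I Y"
    using lu trace_inverse_nonneg[OF X] trace_inverse_nonneg[OF Y]
    by (intro add_mono mult_right_mono)
  finally have p: "(\<Sum>e\<in>E. p e) \<le> 2 * T" using T by simp
  have q: "(\<Sum>e\<in>E. q e) \<le> 2 * F"
    using sum_norm_frame_le[of X] sum_norm_frame_le[of Y] by (simp add: q_def sum.distrib F_def)
  have "?m = (\<Sum>e\<in>E. 1)" by simp
  also have "\<dots> < (\<Sum>e\<in>E. p e * (?m / (4 * T)) + q e * (?m / (4 * F)))"
  proof (rule sum_strict_mono[OF E])
    fix e assume "e \<in> E"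
    from neg[OF this] consider "p e > 4 * T / ?m" | "q e > 4 * F / ?m" by linarith
    then show "1 < p e * (?m / (4 * T)) + q e * (?m / (4 * F))"
    proof cases
      case 1
      then have "1 < p e * (?m / (4 * T))" using m T by (simp add: field_simps)
      moreover have "0 \<le> q e * (?m / (4 * F))" using q0[of e] m F by (intro mult_nonneg_nonneg) auto
      ultimately show ?thesis by linarith
    next
      case 2
      then have "1 < q e * (?m / (4 * F))" using m F by (simp add: field_simps)
      moreover have "0 \<le> p e * (?m / (4 * T))" using p0[of e] m T by (intro mult_nonneg_nonneg) auto
      ultimately show ?thesis by linarith
    qed
  qed
  also have "\<dots> = (\<Sum>e\<in>E. p e) * (?m / (4 * T)) + (\<Sum>e\<in>E. q e) * (?m / (4 * F))"
    by (simp only: sum.distrib sum_distrib_right)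
  also have "\<dots> \<le> (2 * T) * (?m / (4 * T)) + (2 * F) * (?m / (4 * F))"
    using p q m T F by (intro add_mono mult_right_mono) auto
  also have "\<dots> = ?m" using T F by (simp add: field_simps)
  finally show False by simp
qed

end

text \<open>\<delta>1 belongs to the removal of an edge, \<delta>2 to its reweighting. The ranges
  are those of \<open>1 / (1 - L)\<close> and \<open>- 1 / (1 + L)\<close> for a leverage score
  \<open>L\<close> up to 1/2, and of \<open>- 1 / L\<close> and \<open>1 / (2 - L)\<close> for
  larger ones.\<close>

definition balanced :: "real \<Rightarrow> real \<Rightarrow> bool" where
  "balanced \<delta>1 \<delta>2 \<longleftrightarrow> \<delta>1 * \<delta>2 < 0 \<and> 1 \<le> \<bar>\<delta>1\<bar> \<and> \<bar>\<delta>1\<bar> \<le> 2 \<and> 2 / 3 \<le> \<bar>\<delta>2\<bar> \<and> \<bar>\<delta>2\<bar> \<le> 1"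

text \<open>
  With probabilities proportional to \<open>\<bar>\<delta>2\<bar>\<close> and \<open>\<bar>\<delta>1\<bar>\<close> the two updates have mean zero, so the first
  order terms cancel, and the barrier shift, which happens with probability at least \<open>1/4\<close>,
  pays for the second order ones.
\<close>

lemma balanced_average:
  assumes "balanced \<delta>1 \<delta>2" and "0 \<le> B" "0 \<le> D"
    and "T1 \<le> T - \<delta>1 * N + 16 / 15 * \<delta>1\<^sup>2 * B - D" and "T2 \<le> T - \<delta>2 * N + 16 / 15 * \<delta>2\<^sup>2 * B"
  shows "T1 \<le> T + (32 / 15 * B - D / 4) \<or> T2 \<le> T + (32 / 15 * B - D / 4)"
proof (rule ccontr)
  define a where "a = \<bar>\<delta>1\<bar>"
  define b where "b = \<bar>\<delta>2\<bar>"
  let ?R = "32 / 15 * B - D / 4"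
  note bal = assms(1)[unfolded balanced_def, folded a_def b_def]
  assume "\<not> ?thesis"
  then have "T + ?R < T1" "T + ?R < T2" by auto
  then have "b * (T + ?R) < b * T1" "a * (T + ?R) < a * T2"
    using bal by (intro mult_strict_left_mono; linarith)+
  moreover have "b * T1 \<le> b * (T - \<delta>1 * N + 16 / 15 * \<delta>1\<^sup>2 * B - D)"
    "a * T2 \<le> a * (T - \<delta>2 * N + 16 / 15 * \<delta>2\<^sup>2 * B)"
    using assms(4,5) bal by (intro mult_left_mono; linarith)+
  ultimately have "b * (T + ?R) + a * (T + ?R) <
    b * (T - \<delta>1 * N + 16 / 15 * \<delta>1\<^sup>2 * B - D) + a * (T - \<delta>2 * N + 16 / 15 * \<delta>2\<^sup>2 * B)" by linarith
  also have "\<delta>1\<^sup>2 = a * a" by (simp add: power2_eq_square a_def)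
  also have "\<delta>2\<^sup>2 = b * b" by (simp add: power2_eq_square b_def)
  also have "b * (T - \<delta>1 * N + 16 / 15 * (a * a) * B - D) + a * (T - \<delta>2 * N + 16 / 15 * (b * b) * B)
    = (a + b) * T - (b * \<delta>1 + a * \<delta>2) * N + 16 / 15 * ((a * b) * ((a + b) * B)) - b * D"
    by (simp add: algebra_simps)
  also have "b * \<delta>1 + a * \<delta>2 = 0" using bal by (auto simp: a_def b_def abs_if mult_less_0_iff)
  finally have "(a + b) * ?R < 16 / 15 * ((a * b) * ((a + b) * B)) - b * D"
    by (simp add: algebra_simps add_divide_distrib)
  \<comment> \<open>\<open>a * b\<close> is at most 2, which doubles 16/15; next, \<open>a\<close>
    is at most 2, hence at most \<open>3 * b\<close>, which is the probability 1/4.\<close>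
  moreover have "(a * b) * ((a + b) * B) \<le> (2 * 1) * ((a + b) * B)"
    using bal assms(2) by (intro mult_right_mono mult_mono) auto
  moreover have "(a + b) * D \<le> (4 * b) * D" using bal assms(3) by (intro mult_right_mono) auto
  moreover have "(a + b) * ?R = 32 / 15 * ((a + b) * B) - (a + b) * D / 4" by (simp add: algebra_simps add_divide_distrib)
  ultimately show False by linarith
qed

text \<open>The vector is chosen before the coefficients, which depend on the leverage score of the
  edge. With K = T0 F / m^2, the second order error is at most 32/15 * 16 K, below 35 K, while a
  quarter of \<open>s * F / 2\<close> is at least 50 K; the surplus covers the guaranteed decrease.
  Only the removal shifts the barriers.\<close>

lemma barrier_round:
  assumes wb: "within_barriers I M l u T" and T: "T \<le> T0" "0 < T0"
    and M: "\<And>i j. i \<in> I \<Longrightarrow> j \<in> I \<Longrightarrow> M i j = (\<Sum>e\<in>E. v e i * v e j)"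
    and E: "finite E" and I: "I \<noteq> {}" and lu: "l \<le> 2" "u \<le> 2"
    and m: "128 * T0 \<le> card E" and s: "400 * T0 / (real (card E))\<^sup>2 \<le> s" "8 * s * T0 \<le> 1"
  shows "\<exists>e\<in>E. \<forall>\<delta>1 \<delta>2. balanced \<delta>1 \<delta>2 \<longrightarrow>
    within_barriers I (rank_one_update M \<delta>1 (v e)) (l - s) (u + s) (T - T0 / (4 * (real (card E))\<^sup>2)) \<or>
    within_barriers I (rank_one_update M \<delta>2 (v e)) l u (T - T0 / (4 * (real (card E))\<^sup>2))"
proof -
  let ?m = "real (card E)"
  from wb obtain X Y where X: "posdef_inverse I (\<lambda>i j. scalar_mat u i j - M i j) X"
    and Y: "posdef_inverse I (\<lambda>i j. M i j - scalar_mat l i j) Y"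
    and XY: "trace_on I X + trace_on I Y \<le> T" by (auto simp: within_barriers_def)
  define F where "F = frobenius I X + frobenius I Y"
  have m0: "?m > 0" using m T by linarith
  then have "E \<noteq> {}" by auto
  have XY0: "trace_on I X + trace_on I Y \<le> T0" using XY T by simp
  obtain e where e: "e \<in> E" and \<tau>: "quad_form I X (v e) + quad_form I Y (v e) \<le> 4 * T0 / ?m"
    and n: "inner_on I (mat_vec I X (v e)) (mat_vec I X (v e)) +
      inner_on I (mat_vec I Y (v e)) (mat_vec I Y (v e)) \<le> 4 * F / ?m"
    using exists_cheap_vector[OF X Y M lu XY0 T(2) E \<open>E \<noteq> {}\<close> I] unfolding F_def by blast
  define \<tau>X where "\<tau>X = quad_form I X (v e)"
  define \<tau>Y where "\<tau>Y = quad_form I Y (v e)"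
  define nX where "nX = inner_on I (mat_vec I X (v e)) (mat_vec I X (v e))"
  define nY where "nY = inner_on I (mat_vec I Y (v e)) (mat_vec I Y (v e))"
  have \<tau>0: "0 \<le> \<tau>X" "0 \<le> \<tau>Y"
    using quad_form_inverse_nonneg[OF X] quad_form_inverse_nonneg[OF Y] by (auto simp: \<tau>X_def \<tau>Y_def)
  have n0: "0 \<le> nX" "0 \<le> nY" by (simp_all add: nX_def nY_def inner_on_self_nonneg)
  \<comment> \<open>The 128 in the hypothesis is the 4 of the averaging times the 32 of
    \<open>barrier_step\<close>.\<close>
  have "4 * T0 / ?m \<le> 1 / 32" using m m0 by (simp add: field_simps)
  then have \<tau>32: "\<tau>X \<le> 1 / 32" "\<tau>Y \<le> 1 / 32" using \<tau> \<tau>0 by (auto simp: \<tau>X_def \<tau>Y_def)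
  have tr0: "0 \<le> trace_on I X" "0 \<le> trace_on I Y"
    using trace_inverse_nonneg[OF X] trace_inverse_nonneg[OF Y] by auto
  have "0 \<le> 400 * T0 / ?m\<^sup>2" using T(2) by simp
  then have s0: "0 \<le> s" using s(1) by linarith
  have "8 * s * trace_on I X \<le> 8 * s * T0" "8 * s * trace_on I Y \<le> 8 * s * T0"
    using s0 XY0 tr0 by (auto intro!: mult_left_mono)
  then have sX: "8 * s * trace_on I X \<le> 1" and sY: "8 * s * trace_on I Y \<le> 1" using s(2) by auto
  \<comment> \<open>Used with \<open>r = s\<close> for the removal and \<open>r = 0\<close> for the
    reweighting. The first order terms of the two barriers combine to
    \<open>nY - nX\<close>.\<close>
  have upd: "\<exists>T'. within_barriers I (rank_one_update M \<delta> (v e)) (l - r) (u + r) T' \<and>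
      T' \<le> (trace_on I X + trace_on I Y) - \<delta> * (nY - nX) + 16 / 15 * \<delta>\<^sup>2 * (\<tau>X * nX + \<tau>Y * nY) - r * F / 2"
    if \<delta>: "\<bar>\<delta>\<bar> \<le> 2" and r: "0 \<le> r" "8 * r * trace_on I X \<le> 1" "8 * r * trace_on I Y \<le> 1" for \<delta> r
  proof -
    obtain X' where X': "posdef_inverse I
        (\<lambda>i j. scalar_mat u i j - M i j + - \<delta> * v e i * v e j + (if i = j then r else 0)) X'"
      "trace_on I X' \<le> trace_on I X - - \<delta> * nX + 16 / 15 * (- \<delta>)\<^sup>2 * \<tau>X * nX - r * frobenius I X / 2"
      using barrier_step[OF X, of "v e" "- \<delta>" r] \<delta> r \<tau>32 unfolding nX_def \<tau>X_def by auto
    obtain Y' where Y': "posdef_inverse I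
        (\<lambda>i j. M i j - scalar_mat l i j + \<delta> * v e i * v e j + (if i = j then r else 0)) Y'"
      "trace_on I Y' \<le> trace_on I Y - \<delta> * nY + 16 / 15 * \<delta>\<^sup>2 * \<tau>Y * nY - r * frobenius I Y / 2"
      using barrier_step[OF Y, of "v e" \<delta> r] \<delta> r \<tau>32 unfolding nY_def \<tau>Y_def by auto
    have "posdef_inverse I (\<lambda>i j. scalar_mat (u + r) i j - rank_one_update M \<delta> (v e) i j) X'"
      by (rule posdef_inverse_cong[OF X'(1)]) (simp add: scalar_mat_def rank_one_update_def)
    moreover have "posdef_inverse I (\<lambda>i j. rank_one_update M \<delta> (v e) i j - scalar_mat (l - r) i j) Y'"
      by (rule posdef_inverse_cong[OF Y'(1)]) (simp add: scalar_mat_def rank_one_update_def)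
    ultimately have "within_barriers I (rank_one_update M \<delta> (v e)) (l - r) (u + r)
      (trace_on I X' + trace_on I Y')" by (auto simp: within_barriers_def)
    then show ?thesis using X'(2) Y'(2)
      by (intro exI[of _ "trace_on I X' + trace_on I Y'"]) (simp add: F_def algebra_simps add_divide_distrib)
  qed
  have "card I > 0" using I posdef_inverse_finite[OF X] by (simp add: card_gt_0_iff)
  then have F: "F \<ge> 1 / 4" using frobenius_upper_ge[OF X Y M lu] frobenius_nonneg[of I Y] by (simp add: F_def)
  define B where "B = \<tau>X * nX + \<tau>Y * nY"
  define K where "K = T0 * F / ?m\<^sup>2"
  have "B \<le> (\<tau>X + \<tau>Y) * (nX + nY)" using \<tau>0 n0 by (simp add: B_def algebra_simps)
  also have "\<dots> \<le> (4 * T0 / ?m) * (4 * F / ?m)"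
    using \<tau> n \<tau>0 n0 T m0 by (intro mult_mono) (auto simp: \<tau>X_def \<tau>Y_def nX_def nY_def)
  finally have B: "B \<le> 16 * K" by (simp add: power2_eq_square K_def)
  have B0: "0 \<le> B" using \<tau>0 n0 by (simp add: B_def)
  have "400 * T0 / ?m\<^sup>2 * F \<le> s * F" using s F by (intro mult_right_mono) auto
  then have sF: "400 * K \<le> s * F" by (simp add: K_def)
  have "T0 / ?m\<^sup>2 * (1 / 4) \<le> T0 / ?m\<^sup>2 * F" using F T by (intro mult_left_mono) auto
  then have "T0 / (4 * ?m\<^sup>2) \<le> K" by (simp add: K_def)
  moreover have "0 \<le> K" using F T by (simp add: K_def)
  ultimately have gain: "32 / 15 * B - s * F / 2 / 4 \<le> - (T0 / (4 * ?m\<^sup>2))"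
    using B sF by linarith
  have D0: "0 \<le> s * F / 2" using s0 F by simp
  have "within_barriers I (rank_one_update M \<delta>1 (v e)) (l - s) (u + s) (T - T0 / (4 * ?m\<^sup>2)) \<or>
    within_barriers I (rank_one_update M \<delta>2 (v e)) l u (T - T0 / (4 * ?m\<^sup>2))"
    if bal: "balanced \<delta>1 \<delta>2" for \<delta>1 \<delta>2
  proof -
    have \<delta>: "\<bar>\<delta>1\<bar> \<le> 2" "\<bar>\<delta>2\<bar> \<le> 2" using bal by (auto simp: balanced_def)
    obtain T1 where T1: "within_barriers I (rank_one_update M \<delta>1 (v e)) (l - s) (u + s) T1"
      "T1 \<le> (trace_on I X + trace_on I Y) - \<delta>1 * (nY - nX) + 16 / 15 * \<delta>1\<^sup>2 * B - s * F / 2"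
      using upd[OF \<delta>(1) s0 sX sY] by (auto simp: B_def)
    obtain T2 where T2: "within_barriers I (rank_one_update M \<delta>2 (v e)) l u T2"
      "T2 \<le> (trace_on I X + trace_on I Y) - \<delta>2 * (nY - nX) + 16 / 15 * \<delta>2\<^sup>2 * B"
      using upd[OF \<delta>(2), of 0] by (auto simp: B_def)
    have "T1 \<le> trace_on I X + trace_on I Y + (32 / 15 * B - s * F / 2 / 4) \<or>
      T2 \<le> trace_on I X + trace_on I Y + (32 / 15 * B - s * F / 2 / 4)"
      by (rule balanced_average[OF bal B0 D0 T1(2) T2(2)])
    then have "T1 \<le> T - T0 / (4 * ?m\<^sup>2) \<or> T2 \<le> T - T0 / (4 * ?m\<^sup>2)" using gain XY by linarith
    then show ?thesis using within_barriers_mono[OF T1(1)] within_barriers_mono[OF T2(1)] by blast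
  qed
  then show ?thesis using e by auto
qed

text \<open>\<open>P m M\<close> stands for: some network with \<open>m\<close> edges has the form
  \<open>M\<close>. This keeps graphs out of the descent and lets the vectors differ from round to
  round.\<close>

definition removal_step ::
    "'i set \<Rightarrow> (nat \<Rightarrow> ('i \<Rightarrow> 'i \<Rightarrow> real) \<Rightarrow> bool) \<Rightarrow> 'e set \<Rightarrow> ('e \<Rightarrow> 'i \<Rightarrow> real) \<Rightarrow> ('i \<Rightarrow> 'i \<Rightarrow> real) \<Rightarrow> bool"
  where "removal_step I P E v M \<longleftrightarrow> finite E \<and> (\<forall>i\<in>I. \<forall>j\<in>I. M i j = (\<Sum>e\<in>E. v e i * v e j)) \<and>
    (\<forall>e\<in>E. \<exists>\<delta>1 \<delta>2. balanced \<delta>1 \<delta>2 \<and> P (card E - 1) (rank_one_update M \<delta>1 (v e)) \<and>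
       P (card E) (rank_one_update M \<delta>2 (v e)))"

text \<open>
  The outcome that keeps the number of vectors lowers the nonnegative potential by a fixed amount,
  so it can occur only finitely often before a vector is removed.
\<close>

lemma barrier_removal:
  fixes P :: "nat \<Rightarrow> ('i \<Rightarrow> 'i \<Rightarrow> real) \<Rightarrow> bool"
  assumes step: "\<And>m M. P m M \<Longrightarrow> \<exists>(E :: 'e set) v. card E = m \<and> removal_step I P E v M"
    and T0: "0 < T0" and I: "I \<noteq> {}" and lu: "l \<le> 2" "u \<le> 2"
    and m: "128 * T0 \<le> real m" and s: "400 * T0 / (real m)\<^sup>2 \<le> s" "8 * s * T0 \<le> 1"
    and P: "P m M" and wb: "within_barriers I M l u T0"
  shows "\<exists>M'. P (m - 1) M' \<and> within_barriers I M' (l - s) (u + s) T0"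
proof -
  define \<eta> where "\<eta> = T0 / (4 * (real m)\<^sup>2)"
  have "real m > 0" using m T0 by linarith
  then have \<eta>: "\<eta> > 0" using T0 by (simp add: \<eta>_def)
  have round: "(\<exists>M'. P (m - 1) M' \<and> within_barriers I M' (l - s) (u + s) (T - \<eta>)) \<or>
      (\<exists>M'. P m M' \<and> within_barriers I M' l u (T - \<eta>))"
    if PM: "P m M" and wbM: "within_barriers I M l u T" and TM: "T \<le> T0" for M T
  proof -
    obtain E :: "'e set" and v where E: "card E = m" "removal_step I P E v M"
      using step[OF PM] by blast
    then have Mv: "M i j = (\<Sum>e\<in>E. v e i * v e j)" if "i \<in> I" "j \<in> I" for i j
      using that by (auto simp: removal_step_def)
    have "finite E" using E by (simp add: removal_step_def)
    then obtain e where e: "e \<in> E" "\<And>\<delta>1 \<delta>2. balanced \<delta>1 \<delta>2 \<Longrightarrow>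
        within_barriers I (rank_one_update M \<delta>1 (v e)) (l - s) (u + s) (T - \<eta>) \<or>
        within_barriers I (rank_one_update M \<delta>2 (v e)) l u (T - \<eta>)"
      using barrier_round[OF wbM TM T0 Mv _ I lu, where s = s] m s E(1) unfolding \<eta>_def by auto
    then show ?thesis using E by (fastforce simp: removal_step_def)
  qed
  \<comment> \<open>Induction on a bound \<open>n\<close> for the number of rounds that the
    potential can still afford; at 0 the next potential would be negative.\<close>
  have main: "\<exists>M'. P (m - 1) M' \<and> within_barriers I M' (l - s) (u + s) T0"
    if "P m M" "within_barriers I M l u T" "T \<le> T0" "T \<le> real n * \<eta>" for n M T
    using that
  proof (induction n arbitrary: M T)
    case 0
    then show ?case using round[OF 0(1-3)] within_barriers_nonneg \<eta> by fastforce
  next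
    case (Suc n)
    from round[OF Suc.prems(1-3)] show ?case
    proof (elim disjE exE conjE)
      fix M' assume "P (m - 1) M'" "within_barriers I M' (l - s) (u + s) (T - \<eta>)"
      then show ?thesis using within_barriers_mono[of I M' _ _ "T - \<eta>" T0] Suc.prems \<eta> by force
    next
      fix M' assume "P m M'" "within_barriers I M' l u (T - \<eta>)"
      then show ?thesis
        by (rule Suc.IH) (use Suc.prems \<eta> in \<open>simp_all add: algebra_simps\<close>)
    qed
  qed
  obtain n where "T0 < real n * \<eta>" using reals_Archimedean3[OF \<eta>] by blast
  then show ?thesis using main[OF P wb, of n] by simp
qed

text \<open>With \<open>k\<close> vectors left the barriers are 1 - g k and 1 + g k, where g k =
  \<epsilon> / 2 + c / k. The increments of c / k telescope and dominate the shift that a removal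
  requires; the descent stops near \<open>m0\<close>, where c / k has grown to \<epsilon> /
  2.\<close>

theorem barrier_process:
  fixes P :: "nat \<Rightarrow> ('i \<Rightarrow> 'i \<Rightarrow> real) \<Rightarrow> bool"
  assumes step: "\<And>m M. P m M \<Longrightarrow> \<exists>(E :: 'e set) v. card E = m \<and> removal_step I P E v M"
    and fin: "finite I" and \<epsilon>: "0 < \<epsilon>" "\<epsilon> < 1" and P: "P m (scalar_mat 1)"
  shows "\<exists>k M. P k M \<and> real k \<le> 3201 * card I / \<epsilon>\<^sup>2 \<and>
    (\<forall>x. (1 - \<epsilon>) * inner_on I x x \<le> quad_form I M x \<and> quad_form I M x \<le> (1 + \<epsilon>) * inner_on I x x)"
proof (cases "I = {}")
  case True
  \<comment> \<open>In dimension 0 the bound leaves no edge at all, but every form is trivial, so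
    any vector may be removed until none is left.\<close>
  have "\<exists>M. P 0 M" if "P m M" for M
    using that
  proof (induction m arbitrary: M)
    case (Suc m)
    obtain E :: "'e set" and v where E: "card E = Suc m" "removal_step I P E v M"
      using step[OF Suc.prems] by blast
    then obtain e where "e \<in> E" by fastforce
    then have "\<exists>M'. P m M'" using E by (fastforce simp: removal_step_def)
    then show ?case using Suc.IH by blast
  qed blast
  then obtain M where "P 0 M" using P by blast
  then show ?thesis using True by (intro exI[of _ 0] exI[of _ M]) (simp add: quad_form_def inner_on_def)
next
  case False
  define d where "d = real (card I)"
  have d: "d \<ge> 1" using False fin by (simp add: d_def card_gt_0_iff Suc_le_eq)
  \<comment> \<open>Initial barriers at distance at least \<epsilon> / 2 from 1 give a potential of
    at most twice \<open>d / (\<epsilon> / 2)\<close>.\<close>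
  define T0 where "T0 = 4 * d / \<epsilon>"
  define c where "c = 400 * T0"
  define m0 where "m0 = 2 * c / \<epsilon>"
  have T0: "T0 > 0" using d \<epsilon> by (simp add: T0_def)
  have c: "c > 0" using T0 by (simp add: c_def)
  have m0: "m0 = 3200 * d / \<epsilon>\<^sup>2" by (simp add: m0_def c_def T0_def power2_eq_square)
  have m0T: "m0 \<ge> 800 * T0" using T0 \<epsilon> by (simp add: m0_def c_def field_simps)
  \<comment> \<open>The extra 1 is for rounding: the descent ends at an integer between
    \<open>m0\<close> and \<open>m0 + 1\<close>.\<close>
  have m0_bound: "m0 + 1 \<le> 3201 * d / \<epsilon>\<^sup>2"
  proof -
    have "\<epsilon>\<^sup>2 \<le> 1" using \<epsilon> by (simp add: power_le_one)
    then have "1 \<le> d / \<epsilon>\<^sup>2" using d \<epsilon> by (simp add: field_simps)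
    then show ?thesis unfolding m0 by simp
  qed
  define g where "g k = \<epsilon> / 2 + c / k" for k :: real
  have g_le: "g k \<le> \<epsilon>" if "k \<ge> m0" for k
  proof -
    have "k > 0" using that m0T T0 by linarith
    moreover have "2 * c \<le> k * \<epsilon>" using that \<epsilon> by (simp add: m0_def field_simps)
    ultimately have "c / k \<le> \<epsilon> / 2" by (simp add: field_simps)
    then show ?thesis unfolding g_def by linarith
  qed
  have g_ge: "g k \<ge> \<epsilon> / 2" if "k \<ge> 0" for k using that c by (simp add: g_def)
  have inner_mono: "a * inner_on I x x \<le> b * inner_on I x x" if "a \<le> b" for a b x
    by (rule mult_right_mono[OF that inner_on_self_nonneg])
  show ?thesis
  proof (cases "real m < m0")
    case True
    \<comment> \<open>The start is already small enough, so nothing is removed.\<close>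
    show ?thesis using True P m0_bound inner_mono[of "1 - \<epsilon>" 1] inner_mono[of 1 "1 + \<epsilon>"] \<epsilon>
      by (intro exI[of _ m] exI[of _ "scalar_mat 1"]) (simp add: quad_form_scalar_mat[OF fin] d_def)
  next
    case False
    have descend: "\<exists>k M. P k M \<and> m0 \<le> real k \<and> real k \<le> m0 + 1 \<and>
        within_barriers I M (1 - g k) (1 + g k) T0"
      if "P k M" "m0 \<le> real k" "within_barriers I M (1 - g k) (1 + g k) T0" for k M
      using that
    proof (induction k arbitrary: M)
      case 0
      then show ?case using m0T T0 by simp
    next
      case (Suc k)
      show ?case
      proof (cases "real (Suc k) \<le> m0 + 1")
        case True
        then show ?thesis using Suc.prems by blast
      next
        case False
        let ?K = "real (Suc k)"
        define s where "s = g k - g ?K"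
        have k: "real k > m0" "real k > 0" using False m0T T0 by auto
        have "s = c / real k - c / ?K" by (simp add: s_def g_def)
        also have "\<dots> = c / (real k * ?K)" using k by (simp add: divide_simps) (simp add: algebra_simps)
        finally have s: "s = c / (real k * ?K)" .
        have "400 * T0 / ?K\<^sup>2 \<le> s"
          unfolding s c_def using k T0 by (intro frac_le) (auto simp: power2_eq_square)
        moreover have "8 * s * T0 \<le> 1"
        proof -
          have "(800 * T0) * (800 * T0) \<le> real k * ?K" using k m0T T0 by (intro mult_mono) auto
          moreover have "0 \<le> T0 * T0" by simp
          ultimately have "8 * c * T0 \<le> real k * ?K" unfolding c_def by linarith
          moreover have "8 * s * T0 = 8 * c * T0 / (real k * ?K)" by (simp add: s)
          moreover have "0 < real k * ?K" using k by (intro mult_pos_pos) auto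
          ultimately show ?thesis by (simp only: divide_le_eq_1_pos)
        qed
        moreover have "128 * T0 \<le> ?K" using k m0T T0 by simp
        moreover have "1 - g ?K \<le> 2" "1 + g ?K \<le> 2"
          using g_ge[of ?K] g_le[of ?K] Suc.prems \<epsilon> by auto
        ultimately obtain M' where "P k M'" "within_barriers I M' (1 - g ?K - s) (1 + g ?K + s) T0"
          using barrier_removal[OF step T0 \<open>I \<noteq> {}\<close> _ _ _ _ _ Suc.prems(1,3), of s] by auto
        then show ?thesis using Suc.IH[of M'] k by (simp add: s_def)
      qed
    qed
    have g0: "g m > 0" "g m \<ge> \<epsilon> / 2" using g_ge[of m] \<epsilon> by auto
    have "real (card I) / g m \<le> d / (\<epsilon> / 2)"
      unfolding d_def using g0 \<epsilon> by (intro divide_left_mono) auto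
    then have "real (card I) / (1 + g m - 1) + real (card I) / (1 - (1 - g m)) \<le> T0"
      by (simp add: T0_def)
    then have "within_barriers I (scalar_mat 1) (1 - g m) (1 + g m) T0"
      using within_barriers_mono[OF within_barriers_scalar[OF fin, of "1 - g m" 1 "1 + g m"]] g0 by simp
    then obtain k M where k: "P k M" "m0 \<le> real k" "real k \<le> m0 + 1"
        "within_barriers I M (1 - g k) (1 + g k) T0"
      using descend[OF P] False by auto
    show ?thesis
      using k m0_bound within_barriers_bounds[OF k(4)] g_le[OF k(2)]
        inner_mono[of "1 - \<epsilon>" "1 - g k"] inner_mono[of "1 + g k" "1 + \<epsilon>"]
      by (intro exI[of _ k] exI[of _ M]) (fastforce simp: d_def intro: order_trans)
  qed
qed

section \<open>Electrical flows with contracted and deleted edges\<close>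

definition potential_drop :: "('v, 'e) pre_digraph \<Rightarrow> ('v \<Rightarrow> real) \<Rightarrow> 'e \<Rightarrow> real" where
  "potential_drop G y e = y (tail G e) - y (head G e)"

lemma inner_on_incidence:
  assumes "finite (verts G)" "tail G e \<in> verts G" "head G e \<in> verts G"
  shows "inner_on (verts G) (incidence G e) y = potential_drop G y e"
  using assms
  by (simp add: inner_on_def incidence_def potential_drop_def left_diff_distrib sum_subtractf of_bool_def
      if_distrib[of "\<lambda>a. a * _"] cong: if_cong)

lemma sum_incidence:
  assumes "finite (verts G)" "tail G e \<in> verts G" "head G e \<in> verts G"
  shows "(\<Sum>v\<in>verts G. incidence G e v) = 0"
  using inner_on_incidence[OF assms, of "\<lambda>_. 1"] by (simp add: inner_on_def potential_drop_def)

text \<open>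
  \<open>elec G R C w x y f\<close>: the flow \<open>f\<close> routes the demand \<open>x\<close> and, with the potentials \<open>y\<close>, satisfies
  Ohm's law for conductances \<open>w\<close> on \<open>R\<close>, \<open>\<infinity>\<close> on the contracted edges \<open>C\<close> and \<open>0\<close> on all others.
\<close>

definition elec ::
    "('v, 'e) pre_digraph \<Rightarrow> 'e set \<Rightarrow> 'e set \<Rightarrow> ('e \<Rightarrow> real) \<Rightarrow>
     ('v \<Rightarrow> real) \<Rightarrow> ('v \<Rightarrow> real) \<Rightarrow> ('e \<Rightarrow> real) \<Rightarrow> bool" where
  "elec G R C w x y f \<longleftrightarrow>
     (\<forall>v\<in>verts G. (\<Sum>e\<in>arcs G. incidence G e v * f e) = x v) \<and>
     (\<forall>e\<in>R. f e = w e * potential_drop G y e) \<and>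
     (\<forall>e\<in>C. potential_drop G y e = 0) \<and>
     (\<forall>e\<in>arcs G - R - C. f e = 0)"

text \<open>Solvability for every demand of total 0 stands in for connectedness of the minor: each
  update carries it over directly, without an argument about paths.\<close>

definition network :: "('v, 'e) pre_digraph \<Rightarrow> 'e set \<Rightarrow> 'e set \<Rightarrow> ('e \<Rightarrow> real) \<Rightarrow> bool" where
  "network G R C w \<longleftrightarrow> R \<subseteq> arcs G \<and> C \<subseteq> arcs G \<and> R \<inter> C = {} \<and> (\<forall>e\<in>R. 0 < w e) \<and>
     (\<forall>x. (\<Sum>v\<in>verts G. x v) = 0 \<longrightarrow> (\<exists>y f. elec G R C w x y f))"

lemma potential_drop_linear:
  "potential_drop G (\<lambda>v. y v + a * z v) e = potential_drop G y e + a * potential_drop G z e"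
  by (simp add: potential_drop_def algebra_simps)

context fin_digraph
begin

text \<open>Summation by parts. The potential \<open>y\<close> is arbitrary, so that indicators of
  contracted classes can be inserted later.\<close>

lemma inner_on_flow:
  assumes "\<forall>v\<in>verts G. (\<Sum>e\<in>arcs G. incidence G e v * f e) = x v"
  shows "inner_on (verts G) x y = (\<Sum>e\<in>arcs G. f e * potential_drop G y e)"
proof -
  have "inner_on (verts G) x y = (\<Sum>v\<in>verts G. \<Sum>e\<in>arcs G. f e * (incidence G e v * y v))"
    unfolding inner_on_def
  proof (intro sum.cong refl)
    fix v assume "v \<in> verts G"
    then have "x v * y v = (\<Sum>e\<in>arcs G. incidence G e v * f e) * y v" using assms by simp
    also have "\<dots> = (\<Sum>e\<in>arcs G. f e * (incidence G e v * y v))"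
      unfolding sum_distrib_right by (intro sum.cong refl) simp
    finally show "x v * y v = (\<Sum>e\<in>arcs G. f e * (incidence G e v * y v))" .
  qed
  also have "\<dots> = (\<Sum>e\<in>arcs G. f e * inner_on (verts G) (incidence G e) y)"
    unfolding inner_on_def by (subst sum.swap) (simp add: sum_distrib_left)
  finally show ?thesis by (simp add: inner_on_incidence)
qed

text \<open>Contracted edges contribute nothing because \<open>y'\<close> has no drop there, deleted
  ones because \<open>f\<close> vanishes there.\<close>

lemma elec_inner_on:
  assumes "elec G R C w x y f" "elec G R C w x' y' f'" "R \<subseteq> arcs G" "C \<subseteq> arcs G" "R \<inter> C = {}"
  shows "inner_on (verts G) x y' = (\<Sum>e\<in>R. w e * potential_drop G y e * potential_drop G y' e)"
proof -
  have "inner_on (verts G) x y' = (\<Sum>e\<in>arcs G. f e * potential_drop G y' e)"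
    using assms(1) by (intro inner_on_flow) (simp add: elec_def)
  also have "\<dots> = (\<Sum>e\<in>R. f e * potential_drop G y' e)"
    using assms by (intro sum.mono_neutral_right) (auto simp: elec_def)
  also have "\<dots> = (\<Sum>e\<in>R. w e * potential_drop G y e * potential_drop G y' e)"
    using assms(1) by (intro sum.cong refl) (simp add: elec_def)
  finally show ?thesis .
qed

lemma elec_reciprocity:
  assumes "elec G R C w x y f" "elec G R C w x' y' f'" "R \<subseteq> arcs G" "C \<subseteq> arcs G" "R \<inter> C = {}"
  shows "inner_on (verts G) x y' = inner_on (verts G) x' y"
  unfolding elec_inner_on[OF assms] elec_inner_on[OF assms(2,1,3-)] by (simp add: mult_ac)

text \<open>Moving the demand by the response \<open>(yb, fb)\<close> to a unit current through \<open>e\<close> alters Ohm's law only at \<open>e\<close>.\<close>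

lemma elec_update:
  assumes x: "elec G R C w x y f" and b: "elec G R C w (incidence G e) yb fb" and e: "e \<in> R" "R \<subseteq> arcs G"
    and R': "R' - {e} = R - {e}" "C' - {e} = C - {e}" "\<And>e'. e' \<noteq> e \<Longrightarrow> w' e' = w e'"
    and ohm: "e \<in> R' \<Longrightarrow> w e * (potential_drop G y e - a * potential_drop G yb e) + a =
        w' e * (potential_drop G y e - a * potential_drop G yb e)"
      "e \<in> C' \<Longrightarrow> potential_drop G y e = a * potential_drop G yb e"
      "e \<notin> R' \<Longrightarrow> e \<notin> C' \<Longrightarrow> w e * (potential_drop G y e - a * potential_drop G yb e) + a = 0"
  shows "elec G R' C' w' x (\<lambda>v. y v + - a * yb v) (\<lambda>e'. f e' - a * fb e' + a * of_bool (e' = e))"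
proof -
  have "(\<Sum>e'\<in>arcs G. incidence G e' v * (f e' - a * fb e' + a * of_bool (e' = e))) = x v"
    if v: "v \<in> verts G" for v
  proof -
    have "(\<Sum>e'\<in>arcs G. incidence G e' v * (f e' - a * fb e' + a * of_bool (e' = e))) =
      (\<Sum>e'\<in>arcs G. incidence G e' v * f e') - a * (\<Sum>e'\<in>arcs G. incidence G e' v * fb e')
      + a * (\<Sum>e'\<in>arcs G. incidence G e' v * of_bool (e' = e))"
      by (simp add: distrib_left right_diff_distrib sum.distrib sum_subtractf sum_distrib_left mult.left_commute
          del: sum_mult_of_bool_eq sum_of_bool_mult_eq)
    also have "(\<Sum>e'\<in>arcs G. incidence G e' v * of_bool (e' = e)) = incidence G e v"
    proof -
      have "(\<Sum>e'\<in>arcs G. incidence G e' v * of_bool (e' = e)) =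
        (\<Sum>e'\<in>arcs G. if e' = e then incidence G e v else 0)" by (intro sum.cong) auto
      then show ?thesis using e by auto
    qed
    finally show ?thesis using x b v by (simp add: elec_def)
  qed
  moreover have "f e' - a * fb e' + a * of_bool (e' = e) = w' e' * potential_drop G (\<lambda>v. y v + - a * yb v) e'"
    if "e' \<in> R'" for e'
  proof (cases "e' = e")
    case True
    then show ?thesis using x b e ohm(1) that
      unfolding potential_drop_linear by (simp add: elec_def algebra_simps)
  next
    case False
    then have "e' \<in> R" using that R' by blast
    then show ?thesis using x b False R'(3)
      unfolding potential_drop_linear by (simp add: elec_def algebra_simps)
  qed
  moreover have "potential_drop G (\<lambda>v. y v + - a * yb v) e' = 0" if "e' \<in> C'" for e'
  proof (cases "e' = e")
    case True
    then show ?thesis using ohm(2) that unfolding potential_drop_linear by simp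
  next
    case False
    then have "e' \<in> C" using that R' by blast
    then show ?thesis using x b unfolding potential_drop_linear by (simp add: elec_def)
  qed
  moreover have "f e' - a * fb e' + a * of_bool (e' = e) = 0" if "e' \<in> arcs G - R' - C'" for e'
  proof (cases "e' = e")
    case True
    then show ?thesis using ohm(3) that x b e by (simp add: elec_def algebra_simps)
  next
    case False
    then have "e' \<in> arcs G - R - C" using that R' by blast
    then show ?thesis using x b False by (simp add: elec_def)
  qed
  ultimately show ?thesis by (simp add: elec_def)
qed

end

text \<open>\<open>M\<close> is the Gram matrix of the demands \<open>s i\<close> in the energy form of the network.\<close>

definition realizes ::
    "('v, 'e) pre_digraph \<Rightarrow> 'i set \<Rightarrow> ('i \<Rightarrow> 'v \<Rightarrow> real) \<Rightarrow> 'e set \<Rightarrow> 'e set \<Rightarrow> ('e \<Rightarrow> real) \<Rightarrow>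
     ('i \<Rightarrow> 'i \<Rightarrow> real) \<Rightarrow> bool" where
  "realizes G I s R C w M \<longleftrightarrow> network G R C w \<and>
     (\<exists>Y F. \<forall>i\<in>I. elec G R C w (s i) (Y i) (F i) \<and> (\<forall>j\<in>I. M j i = inner_on (verts G) (s j) (Y i)))"

context fin_digraph
begin

text \<open>
  Replacing the conductance of \<open>e\<close> by \<open>w e + t\<close>, where \<open>t = - w e\<close> deletes and \<open>t = \<infinity>\<close> contracts
  it; \<open>\<alpha> = t / (1 + t * \<rho>)\<close> with \<open>\<rho>\<close> the effective resistance across \<open>e\<close>.
\<close>

lemma realizes_update:
  assumes M: "realizes G I s R C w M" and Y: "\<And>i. i \<in> I \<Longrightarrow> elec G R C w (s i) (Y i) (F i)"
    and b: "elec G R C w (incidence G e) yb fb" and e: "e \<in> R"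
    and R': "R' - {e} = R - {e}" "C' - {e} = C - {e}" "\<And>e'. e' \<noteq> e \<Longrightarrow> w' e' = w e'"
      "R' \<subseteq> arcs G" "C' \<subseteq> arcs G" "R' \<inter> C' = {}" "\<And>e. e \<in> R' \<Longrightarrow> 0 < w' e"
    and ohm: "e \<in> R' \<Longrightarrow> w e * (1 - \<alpha> * potential_drop G yb e) + \<alpha> =
        w' e * (1 - \<alpha> * potential_drop G yb e)"
      "e \<in> C' \<Longrightarrow> 1 = \<alpha> * potential_drop G yb e"
      "e \<notin> R' \<Longrightarrow> e \<notin> C' \<Longrightarrow> w e * (1 - \<alpha> * potential_drop G yb e) + \<alpha> = 0"
    and \<delta>: "\<delta> * w e = - \<alpha>"
  shows "realizes G I s R' C' w' (rank_one_update M \<delta> (\<lambda>i. sqrt (w e) * potential_drop G (Y i) e))"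
proof -
  have net: "network G R C w" using M by (simp add: realizes_def)
  then have RC: "R \<subseteq> arcs G" "C \<subseteq> arcs G" "R \<inter> C = {}" "w e > 0" using e by (auto simp: network_def)
  \<comment> \<open>The correction is linear in the drop across \<open>e\<close>, so the hypotheses
    \<open>ohm\<close>, stated for unit drop, only have to be scaled.\<close>
  define a where "a y = \<alpha> * potential_drop G y e" for y
  have upd: "elec G R' C' w' x (\<lambda>v. y v + - a y * yb v) (\<lambda>e'. f e' - a y * fb e' + a y * of_bool (e' = e))"
    if x: "elec G R C w x y f" for x y f
  proof (rule elec_update[OF x b e RC(1) R'(1-3)])
    let ?g = "potential_drop G y e" and ?\<rho> = "potential_drop G yb e"
    show "w e * (?g - a y * ?\<rho>) + a y = w' e * (?g - a y * ?\<rho>)" if "e \<in> R'"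
      using arg_cong[OF ohm(1)[OF that], of "\<lambda>z. ?g * z"] by (simp add: a_def algebra_simps)
    show "?g = a y * ?\<rho>" if "e \<in> C'"
      using arg_cong[OF ohm(2)[OF that], of "\<lambda>z. ?g * z"] by (simp add: a_def algebra_simps)
    show "w e * (?g - a y * ?\<rho>) + a y = 0" if "e \<notin> R'" "e \<notin> C'"
      using arg_cong[OF ohm(3)[OF that], of "\<lambda>z. ?g * z"] by (simp add: a_def algebra_simps)
  qed
  have "network G R' C' w'"
    unfolding network_def using R' net upd by (meson network_def)
  moreover have "rank_one_update M \<delta> (\<lambda>i. sqrt (w e) * potential_drop G (Y i) e) j i =
      inner_on (verts G) (s j) (\<lambda>v. Y i v + - a (Y i) * yb v)" if ij: "i \<in> I" "j \<in> I" for i j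
  proof -
    obtain Y' F' where Y': "\<forall>i\<in>I. elec G R C w (s i) (Y' i) (F' i) \<and>
        (\<forall>j\<in>I. M j i = inner_on (verts G) (s j) (Y' i))"
      using M by (auto simp: realizes_def)
    have ends: "tail G e \<in> verts G" "head G e \<in> verts G" using e RC by auto
    \<comment> \<open>Potentials are not unique, so those hidden in \<open>realizes\<close> may
      differ from \<open>Y\<close>; two uses of reciprocity show that the Gram entries
      agree.\<close>
    have "M j i = inner_on (verts G) (s j) (Y' i)" using Y' ij by blast
    also have "\<dots> = inner_on (verts G) (s i) (Y j)"
      using Y' ij Y by (intro elec_reciprocity[OF _ _ RC(1-3)]) auto
    also have "\<dots> = inner_on (verts G) (s j) (Y i)"
      using ij Y by (intro elec_reciprocity[OF _ _ RC(1-3)]) auto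
    finally have Mji: "M j i = inner_on (verts G) (s j) (Y i)" .
    have "inner_on (verts G) (s j) yb = potential_drop G (Y j) e"
      using elec_reciprocity[OF Y[OF ij(2)] b RC(1-3)] inner_on_incidence[OF finite_verts ends] by simp
    then have "inner_on (verts G) (s j) (\<lambda>v. Y i v + - a (Y i) * yb v) =
      M j i - a (Y i) * potential_drop G (Y j) e"
      unfolding inner_on_add_right inner_on_scale_right Mji by simp
    also have "\<dots> = M j i + \<delta> * w e * potential_drop G (Y j) e * potential_drop G (Y i) e"
      by (simp add: \<delta> a_def)
    also have "\<dots> = M j i + \<delta> * (sqrt (w e) * sqrt (w e)) * potential_drop G (Y j) e * potential_drop G (Y i) e"
      using RC(4) by simp
    finally show ?thesis by (simp add: rank_one_update_def mult_ac)
  qed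
  ultimately show ?thesis
    unfolding realizes_def using upd Y by (intro conjI exI[of _ "\<lambda>i v. Y i v + - a (Y i) * yb v"]
        exI[of _ "\<lambda>i e'. F i e' - a (Y i) * fb e' + a (Y i) * of_bool (e' = e)"]) auto
qed

text \<open>\<open>L = w e * \<rho>\<close> is the leverage score. Adding \<open>t\<close> to the
  conductance has the coefficient \<open>- t / (w e * (1 + t * \<rho>))\<close>; deletion, doubling,
  contraction and halving are t = - w e, t = w e, t to infinity and t = - w e / 2.\<close>

lemma realizes_removal_step:
  fixes s :: "'i \<Rightarrow> 'a \<Rightarrow> real"
  assumes M: "realizes G I s R C w M"
  shows "\<exists>v. removal_step I (\<lambda>m M. \<exists>R C w. card R = m \<and> realizes G I s R C w M) R v M"
proof -
  have net: "network G R C w" using M by (simp add: realizes_def)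
  then have RC: "R \<subseteq> arcs G" "C \<subseteq> arcs G" "R \<inter> C = {}" "\<And>e. e \<in> R \<Longrightarrow> w e > 0"
    by (auto simp: network_def)
  have finR: "finite R" using RC finite_arcs finite_subset by blast
  obtain Y F where Y: "\<And>i. i \<in> I \<Longrightarrow> elec G R C w (s i) (Y i) (F i)"
      and MY: "\<And>i j. i \<in> I \<Longrightarrow> j \<in> I \<Longrightarrow> M j i = inner_on (verts G) (s j) (Y i)"
    using M by (auto simp: realizes_def)
  define v where "v e = (\<lambda>i. sqrt (w e) * potential_drop G (Y i) e)" for e
  have "M i j = (\<Sum>e\<in>R. v e i * v e j)" if "i \<in> I" "j \<in> I" for i j
  proof -
    have "M i j = (\<Sum>e\<in>R. w e * potential_drop G (Y i) e * potential_drop G (Y j) e)"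
      unfolding MY[OF that(2,1)] using that Y by (intro elec_inner_on[OF _ _ RC(1-3)]) auto
    also have "\<dots> = (\<Sum>e\<in>R. v e i * v e j)"
    proof (intro sum.cong refl)
      fix e assume "e \<in> R"
      then have "w e = sqrt (w e) * sqrt (w e)" using RC(4) by (simp add: less_imp_le)
      then show "w e * potential_drop G (Y i) e * potential_drop G (Y j) e = v e i * v e j"
        unfolding v_def by (metis mult.assoc mult.left_commute)
    qed
    finally show ?thesis .
  qed
  moreover have "\<exists>\<delta>1 \<delta>2. balanced \<delta>1 \<delta>2 \<and>
      (\<exists>R' C w. card R' = card R - 1 \<and> realizes G I s R' C w (rank_one_update M \<delta>1 (v e))) \<and>
      (\<exists>R' C w. card R' = card R \<and> realizes G I s R' C w (rank_one_update M \<delta>2 (v e)))"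
    if e: "e \<in> R" for e
  proof -
    have ends: "tail G e \<in> verts G" "head G e \<in> verts G" and eG: "e \<in> arcs G" using e RC by auto
    obtain yb fb where b: "elec G R C w (incidence G e) yb fb"
      using net sum_incidence[OF finite_verts ends] by (auto simp: network_def)
    define \<rho> where "\<rho> = potential_drop G yb e"
    have we: "w e > 0" using RC(4) e .
    \<comment> \<open>\<open>\<rho>\<close> is the energy of the unit current through
      \<open>e\<close>, and its part on the edge \<open>e\<close> itself is
      \<open>w e * \<rho> * \<rho>\<close>; this is why \<open>L\<close> is at most 1.\<close>
    have "\<rho> = (\<Sum>e'\<in>R. w e' * potential_drop G yb e' * potential_drop G yb e')"
      using elec_inner_on[OF b b RC(1-3)] inner_on_incidence[OF finite_verts ends] by (simp add: \<rho>_def)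
    also have "\<dots> \<ge> w e * potential_drop G yb e * potential_drop G yb e"
      using e finR RC(4) by (intro member_le_sum[of e R "\<lambda>e'. w e' * potential_drop G yb e' * potential_drop G yb e'"])
        (simp_all add: mult.assoc less_imp_le)
    finally have lev: "w e * \<rho> * \<rho> \<le> \<rho>" by (simp add: \<rho>_def)
    have \<rho>0: "\<rho> \<ge> 0" using lev we by (smt (verit) mult_nonneg_nonneg mult.assoc zero_le_square)
    define L where "L = w e * \<rho>"
    have L: "0 \<le> L" "L \<le> 1"
      using lev we \<rho>0 unfolding L_def by (cases "\<rho> = 0"; simp add: mult_le_cancel_right2)+
    have eC: "e \<notin> C" using e RC by auto
    note upd = realizes_update[OF M Y b e, folded v_def \<rho>_def]
    have reweight: "\<exists>R' C w. card R' = card R \<and> realizes G I s R' C w (rank_one_update M \<delta> (v e))"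
      if t: "w e + t > 0" "1 + t * \<rho> > 0" "\<delta> * w e = - (t / (1 + t * \<rho>))" for t \<delta>
    proof (intro exI conjI)
      show "realizes G I s R C (w(e := w e + t)) (rank_one_update M \<delta> (v e))"
      proof (rule upd[where \<alpha> = "t / (1 + t * \<rho>)"])
        have "1 - t / (1 + t * \<rho>) * \<rho> = 1 / (1 + t * \<rho>)" using t(2) by (simp add: field_simps)
        then show "w e * (1 - t / (1 + t * \<rho>) * \<rho>) + t / (1 + t * \<rho>) =
            (w(e := w e + t)) e * (1 - t / (1 + t * \<rho>) * \<rho>)"
          by (simp add: add_divide_distrib)
      qed (use t RC e eC in auto)
    qed simp
    show ?thesis
    proof (cases "L \<le> 1 / 2")
      \<comment> \<open>A loop has \<open>\<rho> = 0\<close> and falls in this case; in the other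
        one it is safe to divide by \<open>\<rho>\<close>.\<close>
      case True
      define \<delta>1 where "\<delta>1 = 1 / (1 - L)"
      define \<delta>2 where "\<delta>2 = - 1 / (1 + L)"
      have "1 \<le> \<delta>1" "\<delta>1 \<le> 2" "- 1 \<le> \<delta>2" "\<delta>2 \<le> - 2 / 3"
        using True L unfolding \<delta>1_def \<delta>2_def by (simp_all add: field_simps)
      then have bal: "balanced \<delta>1 \<delta>2" by (simp add: balanced_def mult_pos_neg)
      have "realizes G I s (R - {e}) C w (rank_one_update M \<delta>1 (v e))"
        using RC True eC we
        by (intro upd[where \<alpha> = "- w e / (1 - L)"]) (auto simp: L_def \<delta>1_def field_simps)
      moreover have "\<exists>R' C w. card R' = card R \<and> realizes G I s R' C w (rank_one_update M \<delta>2 (v e))"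
        using we L by (intro reweight[of "w e"]) (auto simp: L_def \<delta>2_def field_simps)
      ultimately show ?thesis using bal e finR by (metis card_Diff_singleton)
    next
      case False
      define \<delta>1 where "\<delta>1 = - 1 / L"
      define \<delta>2 where "\<delta>2 = 1 / (2 - L)"
      have "- 2 \<le> \<delta>1" "\<delta>1 \<le> - 1" "2 / 3 \<le> \<delta>2" "\<delta>2 \<le> 1"
        using False L unfolding \<delta>1_def \<delta>2_def by (simp_all add: field_simps)
      then have bal: "balanced \<delta>1 \<delta>2" by (simp add: balanced_def mult_neg_pos)
      have "\<rho> \<noteq> 0" using False by (auto simp: L_def)
      then have "realizes G I s (R - {e}) (insert e C) w (rank_one_update M \<delta>1 (v e))"
        using RC eC we eG
        by (intro upd[where \<alpha> = "1 / \<rho>"]) (auto simp: L_def \<delta>1_def field_simps)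
      moreover have "\<exists>R' C w. card R' = card R \<and> realizes G I s R' C w (rank_one_update M \<delta>2 (v e))"
        using we L by (intro reweight[of "- w e / 2"]) (auto simp: L_def \<delta>2_def field_simps)
      ultimately show ?thesis using bal e finR by (metis card_Diff_singleton)
    qed
  qed
  ultimately show ?thesis unfolding removal_step_def using finR by blast
qed

end

section \<open>Pseudoinverses of Laplacians\<close>

lemma mat_mul_assoc:
  "mat_mul K (mat_mul J A B) C = mat_mul J A (mat_mul K B C)"
proof (intro ext)
  fix i j
  have "(\<Sum>k\<in>K. \<Sum>l\<in>J. A i l * B l k * C k j) = (\<Sum>l\<in>J. \<Sum>k\<in>K. A i l * (B l k * C k j))"
    by (subst sum.swap) (simp add: mult.assoc)
  then show "mat_mul K (mat_mul J A B) C i j = mat_mul J A (mat_mul K B C) i j"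
    by (simp add: mat_mul_def sum_distrib_left sum_distrib_right)
qed

lemma mat_transpose_mul:
  "mat_transpose (mat_mul K A B) = mat_mul K (mat_transpose B) (mat_transpose A)"
  by (simp add: mat_transpose_def mat_mul_def mult.commute)

lemma mat_mul_cong:
  "mat_eq I K A A' \<Longrightarrow> mat_eq K J B B' \<Longrightarrow> mat_eq I J (mat_mul K A B) (mat_mul K A' B')"
  by (simp add: mat_eq_def mat_mul_def)

lemma mat_eq_refl: "mat_eq I J A A" and mat_eq_sym: "mat_eq I J A B \<Longrightarrow> mat_eq I J B A"
  and mat_eq_trans [trans]: "mat_eq I J A B \<Longrightarrow> mat_eq I J B C \<Longrightarrow> mat_eq I J A C"
  by (simp_all add: mat_eq_def)

lemma mat_eq_transpose: "mat_eq I J A B \<Longrightarrow> mat_eq J I (mat_transpose A) (mat_transpose B)"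
  by (simp add: mat_eq_def mat_transpose_def)

text \<open>A X and A Y are both the orthogonal projection onto the range of \<open>A\<close>, X A
  and Y A both that onto its row space; then X = X A X = X A Y = Y A Y = Y.\<close>

lemma is_pinv_unique:
  assumes X: "is_pinv I J A X" and Y: "is_pinv I J A Y"
  shows "X = Y"
proof -
  have range: "mat_eq I I (mat_mul J A X) (mat_mul J A Y)" if X: "is_pinv I J A X" and Y: "is_pinv I J A Y" for X Y
  proof -
    let ?P = "mat_mul J A X" and ?Q = "mat_mul J A Y"
    have "mat_eq I I (mat_mul J (mat_mul I ?Q A) X) ?P"
      using Y by (intro mat_mul_cong mat_eq_refl) (simp add: is_pinv_def)
    then have "mat_eq I I ?P (mat_mul I ?Q ?P)"
      unfolding mat_mul_assoc by (rule mat_eq_sym)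
    also have "mat_eq I I \<dots> (mat_mul I (mat_transpose ?Q) (mat_transpose ?P))"
      by (intro mat_mul_cong; rule mat_eq_sym) (use X Y in \<open>simp_all add: is_pinv_def\<close>)
    finally have 1: "mat_eq I I ?P (mat_transpose (mat_mul I ?P ?Q))"
      by (simp add: mat_transpose_mul)
    have "mat_eq I I (mat_mul J (mat_mul I ?P A) Y) ?Q"
      using X by (intro mat_mul_cong mat_eq_refl) (simp add: is_pinv_def)
    then have "mat_eq I I (mat_mul I ?P ?Q) ?Q" unfolding mat_mul_assoc .
    then have "mat_eq I I (mat_transpose (mat_mul I ?P ?Q)) (mat_transpose ?Q)" by (rule mat_eq_transpose)
    with 1 have "mat_eq I I ?P (mat_transpose ?Q)" by (rule mat_eq_trans)
    then show ?thesis by (rule mat_eq_trans) (use Y in \<open>simp add: is_pinv_def\<close>)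
  qed
  have corange: "mat_eq J J (mat_mul I X A) (mat_mul I Y A)" if X: "is_pinv I J A X" and Y: "is_pinv I J A Y" for X Y
  proof -
    let ?P = "mat_mul I X A" and ?Q = "mat_mul I Y A"
    have "mat_eq J J (mat_mul I X (mat_mul I (mat_mul J A Y) A)) ?P"
      using Y by (intro mat_mul_cong mat_eq_refl) (simp add: is_pinv_def)
    then have "mat_eq J J ?P (mat_mul J ?P ?Q)"
      unfolding mat_mul_assoc by (rule mat_eq_sym)
    also have "mat_eq J J \<dots> (mat_mul J (mat_transpose ?P) (mat_transpose ?Q))"
      by (intro mat_mul_cong; rule mat_eq_sym) (use X Y in \<open>simp_all add: is_pinv_def\<close>)
    finally have 1: "mat_eq J J ?P (mat_transpose (mat_mul J ?Q ?P))"
      by (simp add: mat_transpose_mul)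
    have "mat_eq J J (mat_mul I Y (mat_mul I (mat_mul J A X) A)) ?Q"
      using X by (intro mat_mul_cong mat_eq_refl) (simp add: is_pinv_def)
    then have "mat_eq J J (mat_mul J ?Q ?P) ?Q" unfolding mat_mul_assoc .
    then have "mat_eq J J (mat_transpose (mat_mul J ?Q ?P)) (mat_transpose ?Q)" by (rule mat_eq_transpose)
    with 1 have "mat_eq J J ?P (mat_transpose ?Q)" by (rule mat_eq_trans)
    then show ?thesis by (rule mat_eq_trans) (use Y in \<open>simp add: is_pinv_def\<close>)
  qed
  have "mat_eq J I X (mat_mul I X (mat_mul J A X))"
    unfolding mat_mul_assoc[symmetric] by (rule mat_eq_sym) (use X in \<open>simp add: is_pinv_def\<close>)
  also have "mat_eq J I \<dots> (mat_mul I X (mat_mul J A Y))"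
    by (intro mat_mul_cong mat_eq_refl range X Y)
  also have "mat_mul I X (mat_mul J A Y) = mat_mul J (mat_mul I X A) Y" by (simp add: mat_mul_assoc)
  also have "mat_eq J I \<dots> (mat_mul J (mat_mul I Y A) Y)"
    by (intro mat_mul_cong mat_eq_refl corange X Y)
  also have "mat_eq J I \<dots> Y" using Y by (simp add: is_pinv_def)
  finally have XY: "mat_eq J I X Y" .
  show ?thesis
  proof (intro ext)
    fix j i show "X j i = Y j i"
      using XY X Y by (cases "j \<in> J \<and> i \<in> I") (auto simp: mat_eq_def is_pinv_def)
  qed
qed

lemma mat_vec_mat_mul: "mat_vec J (mat_mul K A B) x = mat_vec K A (mat_vec J B x)"
proof
  fix i
  have "(\<Sum>j\<in>J. \<Sum>k\<in>K. A i k * B k j * x j) = (\<Sum>k\<in>K. \<Sum>j\<in>J. A i k * (B k j * x j))"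
    by (subst sum.swap) (simp add: mult.assoc)
  then show "mat_vec J (mat_mul K A B) x i = mat_vec K A (mat_vec J B x) i"
    by (simp add: mat_vec_def mat_mul_def sum_distrib_left sum_distrib_right)
qed

text \<open>Column \<open>v\<close> is the solution of sum 0 for the demand \<open>pr u v\<close>, a
  unit at \<open>v\<close> with its mean removed. Both products with \<open>L\<close> are then
  \<open>pr\<close>, the projection orthogonal to the constants.\<close>

lemma is_pinv_exists:
  fixes V :: "'v set" and L :: "'v \<Rightarrow> 'v \<Rightarrow> real"
  assumes fin: "finite V" "V \<noteq> {}" and sym: "symmetric_on V L" and one: "\<And>v. v \<in> V \<Longrightarrow> (\<Sum>u\<in>V. L v u) = 0"
    and solv: "\<And>x. (\<Sum>v\<in>V. x v) = 0 \<Longrightarrow> \<exists>y. \<forall>v\<in>V. mat_vec V L y v = x v"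
  shows "\<exists>X. is_pinv V V L X"
proof -
  define n where "n = real (card V)"
  have n: "n > 0" using fin by (simp add: n_def card_gt_0_iff)
  define pr where "pr u v = of_bool (u = v) - 1 / n" for u v :: 'v
  have pr0: "(\<Sum>u\<in>V. pr u v) = 0" if "v \<in> V" for v
    using that fin n by (simp add: pr_def sum_subtractf n_def of_bool_def)
  have prsym: "pr u v = pr v u" for u v by (simp add: pr_def)
  have "\<exists>y. (\<forall>u\<in>V. mat_vec V L y u = pr u v) \<and> (\<Sum>u\<in>V. y u) = 0" if v: "v \<in> V" for v
  proof -
    obtain y where y: "\<forall>u\<in>V. mat_vec V L y u = pr u v" using solv[OF pr0[OF v]] by blast
    let ?c = "(\<Sum>u\<in>V. y u) / n"
    have "mat_vec V L (\<lambda>u. y u - ?c) u = pr u v" if "u \<in> V" for u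
    proof -
      have "mat_vec V L (\<lambda>u. y u - ?c) u = mat_vec V L y u - (\<Sum>k\<in>V. L u k) * ?c"
        by (simp only: mat_vec_def right_diff_distrib sum_subtractf sum_distrib_right)
      then show ?thesis using y one[OF that] that by simp
    qed
    moreover have "(\<Sum>u\<in>V. y u - ?c) = 0" using n by (simp add: sum_subtractf n_def)
    ultimately show ?thesis by blast
  qed
  then obtain Y where Y: "\<And>v u. v \<in> V \<Longrightarrow> u \<in> V \<Longrightarrow> mat_vec V L (Y v) u = pr u v"
    "\<And>v. v \<in> V \<Longrightarrow> (\<Sum>u\<in>V. Y v u) = 0" by metis
  define X where "X u v = (if u \<in> V \<and> v \<in> V then Y v u else 0)" for u v
  have LX: "mat_mul V L X u v = pr u v" if "u \<in> V" "v \<in> V" for u v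
    using Y(1)[OF that(2,1)] that by (simp add: mat_mul_def mat_vec_def X_def)
  have X0: "(\<Sum>u\<in>V. X u v) = 0" if "v \<in> V" for v using Y(2)[OF that] that by (simp add: X_def)
  have colL: "(\<Sum>v\<in>V. L v u) = 0" if "u \<in> V" for u
    using one[OF that] symmetric_onD[OF sym that] by simp
  text \<open>The kernel of \<open>L\<close> consists of constants, being orthogonal to its range.\<close>
  have ker: "z v = (\<Sum>u\<in>V. z u) / n" if z: "\<And>u. u \<in> V \<Longrightarrow> mat_vec V L z u = 0" and v: "v \<in> V" for z v
  proof -
    have "inner_on V z (\<lambda>u. pr u v) = inner_on V z (mat_vec V L (Y v))"
      using Y(1) v by (intro inner_on_cong) auto
    also have "\<dots> = inner_on V (Y v) (mat_vec V L z)" by (rule inner_on_mat_vec_symmetric[OF sym])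
    also have "\<dots> = 0" using z by (simp add: inner_on_def)
    finally have "(\<Sum>u\<in>V. z u * of_bool (u = v)) - (\<Sum>u\<in>V. z u) / n = 0"
      by (simp add: inner_on_def pr_def right_diff_distrib sum_subtractf sum_divide_distrib)
    moreover have "(\<Sum>u\<in>V. z u * of_bool (u = v)) = z v" using v fin by (simp add: of_bool_def
        if_distrib[of "\<lambda>a. _ * a"] cong: if_cong)
    ultimately show ?thesis by simp
  qed
  have prL: "mat_mul V pr L u v = L u v" if "u \<in> V" "v \<in> V" for u v
  proof -
    have "mat_mul V pr L u v = (\<Sum>k\<in>V. if u = k then L k v else 0) - (\<Sum>k\<in>V. L k v) / n"
      by (simp add: mat_mul_def pr_def left_diff_distrib sum_subtractf sum_divide_distrib of_bool_def
          if_distrib[of "\<lambda>a. a * _"] cong: if_cong)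
    then show ?thesis using that fin colL by simp
  qed
  have XL: "mat_mul V X L u v = pr u v" if uv: "u \<in> V" "v \<in> V" for u v
  proof -
    \<comment> \<open>\<open>L\<close> annihilates \<open>z\<close>, as L X L = pr L = L = L pr;
      hence \<open>z\<close> is constant, and its sum 0 makes it vanish.\<close>
    define z where "z = (\<lambda>u. mat_mul V X L u v - pr u v)"
    have "mat_vec V L z k = 0" if k: "k \<in> V" for k
    proof -
      have "mat_vec V L z k = mat_mul V (mat_mul V L X) L k v - mat_mul V L pr k v"
        by (simp add: mat_mul_assoc z_def mat_vec_def right_diff_distrib sum_subtractf)
          (simp add: mat_mul_def)
      also have "mat_mul V (mat_mul V L X) L k v = mat_mul V pr L k v"
        unfolding mat_mul_def[of V "mat_mul V L X"] mat_mul_def[of V pr]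
        using LX k by (intro sum.cong refl) simp
      also have "mat_mul V L pr k v = mat_mul V pr L v k"
        unfolding mat_mul_def using k uv symmetric_onD[OF sym] prsym
        by (intro sum.cong refl) (simp add: mult.commute prsym)
      finally show ?thesis using k uv prL symmetric_onD[OF sym] by simp
    qed
    then have "z u = (\<Sum>k\<in>V. z k) / n" using ker uv by blast
    also have "(\<Sum>k\<in>V. z k) = (\<Sum>k\<in>V. mat_mul V X L k v) - (\<Sum>k\<in>V. pr k v)"
      by (simp add: z_def sum_subtractf)
    also have "(\<Sum>k\<in>V. mat_mul V X L k v) = (\<Sum>l\<in>V. (\<Sum>k\<in>V. X k l) * L l v)"
      unfolding mat_mul_def by (subst sum.swap) (simp add: sum_distrib_right)
    also have "\<dots> = 0" using X0 by simp
    finally show ?thesis using pr0 uv by (simp add: z_def)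
  qed
  have "is_pinv V V L X"
    unfolding is_pinv_def mat_eq_def
  proof (intro conjI ballI)
    fix u v assume uv: "u \<in> V" "v \<in> V"
    show "mat_mul V (mat_mul V L X) L u v = L u v"
      using prL[OF uv] LX uv by (simp add: mat_mul_def[of V "mat_mul V L X"] mat_mul_def[of V pr])
    have "mat_mul V (mat_mul V X L) X u v = mat_mul V pr X u v"
      unfolding mat_mul_def[of V "mat_mul V X L"] mat_mul_def[of V pr]
      using XL uv by (intro sum.cong refl) simp
    also have "\<dots> = (\<Sum>k\<in>V. if u = k then X k v else 0) - (\<Sum>k\<in>V. X k v) / n"
      by (simp add: mat_mul_def pr_def left_diff_distrib sum_subtractf sum_divide_distrib of_bool_def
          if_distrib[of "\<lambda>a. a * _"] cong: if_cong)
    finally show "mat_mul V (mat_mul V X L) X u v = X u v" using X0 uv fin by simp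
    show "mat_transpose (mat_mul V L X) u v = mat_mul V L X u v"
      "mat_transpose (mat_mul V X L) u v = mat_mul V X L u v"
      using LX XL uv prsym by (simp_all add: mat_transpose_def)
  qed (auto simp: X_def)
  then show ?thesis by blast
qed

text \<open>Any solution \<open>y\<close> of L y = x may be used, since x^T X x = y^T (L X L) y =
  y^T L y.\<close>

lemma quad_form_pinv:
  assumes sym: "symmetric_on V L" and ex: "\<exists>X. is_pinv V V L X"
    and y: "\<And>v. v \<in> V \<Longrightarrow> mat_vec V L y v = x v"
  shows "quad_form V (pinv V V L) x = inner_on V x y"
proof -
  obtain X where X: "is_pinv V V L X" using ex by blast
  have p: "pinv V V L = X" unfolding pinv_def using X is_pinv_unique by (metis the_equality)
  have "quad_form V X x = inner_on V x (mat_vec V X (mat_vec V L y))"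
    unfolding quad_form_def using y by (metis mat_vec_cong)
  also have "\<dots> = inner_on V (mat_vec V L y) (mat_vec V X (mat_vec V L y))"
    using y by (intro inner_on_cong) auto
  also have "\<dots> = inner_on V (mat_vec V X (mat_vec V L y)) (mat_vec V L y)"
    by (rule inner_on_commute)
  also have "\<dots> = inner_on V y (mat_vec V L (mat_vec V X (mat_vec V L y)))"
    by (rule inner_on_mat_vec_symmetric[OF sym])
  also have "mat_vec V L (mat_vec V X (mat_vec V L y)) = mat_vec V (mat_mul V (mat_mul V L X) L) y"
    by (simp add: mat_vec_mat_mul mat_mul_assoc)
  also have "inner_on V y \<dots> = inner_on V y (mat_vec V L y)"
    unfolding inner_on_mat_vec using X by (intro sum.cong refl) (simp add: is_pinv_def mat_eq_def)
  also have "\<dots> = inner_on V y x" using y by (intro inner_on_cong) auto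
  finally show ?thesis by (simp add: p inner_on_commute)
qed

section \<open>Laplacians as sums over edges\<close>

lemma laplacian_eq:
  assumes "finite (arcs G)"
  shows "laplacian G w u v = (\<Sum>e\<in>arcs G. w e * incidence G e u * incidence G e v)"
proof -
  have "mat_mul (arcs G) (mat_transpose (incidence G)) (mat_diag w) u e = incidence G e u * w e"
    if "e \<in> arcs G" for e
    using that assms by (simp add: mat_mul_def mat_transpose_def mat_diag_def
        if_distrib[of "\<lambda>a. _ * a"] cong: if_cong)
  then show ?thesis by (simp add: laplacian_def mat_mul_def[of _ "mat_mul _ _ _"] mult_ac)
qed

lemma laplacian_symmetric: "finite (arcs G) \<Longrightarrow> symmetric_on V (laplacian G w)"
  by (simp add: symmetric_on_def laplacian_eq mult_ac)

lemma (in fin_digraph) laplacian_mat_vec: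
  "mat_vec (verts G) (laplacian G w) y v = (\<Sum>e\<in>arcs G. incidence G e v * (w e * potential_drop G y e))"
proof -
  have "mat_vec (verts G) (laplacian G w) y v =
    (\<Sum>u\<in>verts G. \<Sum>e\<in>arcs G. incidence G e v * (w e * (incidence G e u * y u)))"
    unfolding mat_vec_def laplacian_eq[OF finite_arcs] sum_distrib_right by (simp add: mult_ac)
  also have "\<dots> = (\<Sum>e\<in>arcs G. incidence G e v * (w e * inner_on (verts G) (incidence G e) y))"
    by (subst sum.swap) (simp add: inner_on_def sum_distrib_left)
  finally show ?thesis by (simp add: inner_on_incidence)
qed

lemma (in fin_digraph) quad_form_laplacian_pinv:
  assumes "verts G \<noteq> {}"
    and solv: "\<And>x. (\<Sum>v\<in>verts G. x v) = 0 \<Longrightarrow>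
      \<exists>y. \<forall>v\<in>verts G. (\<Sum>e\<in>arcs G. incidence G e v * (w e * potential_drop G y e)) = x v"
    and y: "\<And>v. v \<in> verts G \<Longrightarrow> (\<Sum>e\<in>arcs G. incidence G e v * (w e * potential_drop G y e)) = x v"
  shows "quad_form (verts G) (laplacian_pinv G w) x = inner_on (verts G) x y"
proof -
  have "(\<Sum>u\<in>verts G. laplacian G w v u) = 0" for v
  proof -
    have "(\<Sum>u\<in>verts G. laplacian G w v u) = mat_vec (verts G) (laplacian G w) (\<lambda>_. 1) v"
      by (simp add: mat_vec_def)
    also have "\<dots> = 0" unfolding laplacian_mat_vec by (simp add: potential_drop_def)
    finally show ?thesis .
  qed
  then have "\<exists>X. is_pinv (verts G) (verts G) (laplacian G w) X"
    using assms by (intro is_pinv_exists laplacian_symmetric) (auto simp: laplacian_mat_vec)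
  then show ?thesis
    unfolding laplacian_pinv_def using y
    by (intro quad_form_pinv laplacian_symmetric) (auto simp: laplacian_mat_vec)
qed

text \<open>That is, \<open>x - L y\<close> lies in the kernel of \<open>L = (\<Sum>e\<in>E. b e (b e)\<^sup>T)\<close>.\<close>

lemma range_kernel_decomposition:
  fixes b :: "'e \<Rightarrow> 'v \<Rightarrow> real"
  assumes "finite E"
  shows "\<exists>y. \<forall>e\<in>E. inner_on V (b e) (\<lambda>v. x v - (\<Sum>e\<in>E. b e v * inner_on V (b e) y)) = 0"
  using assms
proof (induction E arbitrary: x rule: finite_induct)
  case empty
  then show ?case by simp
next
  case (insert e E)
  define L where "L y v = (\<Sum>e\<in>E. b e v * inner_on V (b e) y)" for y v
  have L_lin: "L (\<lambda>v. y v + a * z v) v = L y v + a * L z v" for y z a v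
    by (simp add: L_def inner_on_linear algebra_simps sum.distrib sum_distrib_left)
  have L_inner: "inner_on V z (L y) = (\<Sum>e\<in>E. inner_on V (b e) z * inner_on V (b e) y)" for z y
    unfolding L_def inner_on_def[of V z] sum_distrib_left
    by (subst sum.swap) (simp add: inner_on_def[of V "b _" z] sum_distrib_right mult_ac del: mult.commute)
  obtain y h where y: "\<forall>e'\<in>E. inner_on V (b e') (\<lambda>v. x v - L y v) = 0"
    and h: "\<forall>e'\<in>E. inner_on V (b e') (\<lambda>v. b e v - L h v) = 0"
    using insert.IH[of x] insert.IH[of "b e"] unfolding L_def by blast
  \<comment> \<open>\<open>r\<close> and \<open>n\<close> are the kernel parts of \<open>x\<close>
    and of the new vector \<open>b e\<close>; the new residual is sought in the form
    \<open>r + \<gamma> * n\<close>.\<close>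
  define r where "r = (\<lambda>v. x v - L y v)"
  define n where "n = (\<lambda>v. b e v - L h v)"
  have orth: "inner_on V z (L z') = 0" if "\<forall>e'\<in>E. inner_on V (b e') z = 0" for z z'
    using that by (simp add: L_inner)
  have Ln: "L n v = 0" for v using h by (simp add: L_def[of n] n_def[symmetric])
  let ?be = "inner_on V (b e)"
  have L': "(\<Sum>e'\<in>insert e E. b e' v * inner_on V (b e') z) = L z v + b e v * ?be z" for z v
    using insert.hyps by (simp add: L_def add.commute)
  have ben: "?be n = inner_on V n n"
  proof -
    have "inner_on V n n = inner_on V n (b e) - inner_on V n (L h)"
      unfolding n_def[of] by (subst (2) n_def[symmetric]) (simp add: n_def inner_on_diff_right)
    then show ?thesis using orth[of n h] h by (simp add: n_def[symmetric] inner_on_commute)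
  qed
  have beh: "?be h \<ge> 0" if "?be n = 0"
  proof -
    have "\<forall>v\<in>V. n v = 0 \<or> \<not> finite V" using that ben
      by (auto simp: inner_on_def sum_nonneg_eq_0_iff)
    \<comment> \<open>For infinite \<open>V\<close> every \<open>inner_on\<close> is 0 by
      default.\<close>
    then have "inner_on V h n = 0" by (cases "finite V") (auto simp: inner_on_def)
    then have "inner_on V h (b e) = inner_on V h (L h)" by (simp add: n_def inner_on_diff_right)
    then show ?thesis by (simp add: L_inner inner_on_commute sum_nonneg)
  qed
  \<comment> \<open>If \<open>n\<close> vanishes on a finite \<open>V\<close>, \<open>r\<close> is
    already orthogonal to \<open>b e\<close>, and \<gamma> only has to satisfy
    \<open>?be y' = - \<gamma>\<close>, where \<open>beh\<close> keeps the denominator positive.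
    Otherwise \<gamma> makes the residual orthogonal and \<alpha> enforces that equation.\<close>
  define \<gamma> where "\<gamma> = (if ?be n = 0 then - ?be y / (1 + ?be h) else - ?be r / ?be n)"
  define \<alpha> where "\<alpha> = (if ?be n = 0 then 0 else (- \<gamma> - ?be y - \<gamma> * ?be h) / ?be n)"
  define y' where "y' = (\<lambda>v. (y v + \<gamma> * h v) + \<alpha> * n v)"
  have bey': "?be y' = - \<gamma>"
  proof -
    have "?be y' = ?be y + \<gamma> * ?be h + \<alpha> * ?be n"
      by (simp add: y'_def inner_on_add_right inner_on_scale_right)
    moreover have "\<alpha> * ?be n = (if ?be n = 0 then 0 else - \<gamma> - ?be y - \<gamma> * ?be h)"
      by (simp add: \<alpha>_def)
    moreover have "?be n = 0 \<Longrightarrow> \<gamma> * (1 + ?be h) = - ?be y" using beh by (simp add: \<gamma>_def)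
    ultimately show ?thesis by (auto simp: algebra_simps split: if_splits)
  qed
  have res: "x v - (\<Sum>e'\<in>insert e E. b e' v * inner_on V (b e') y') = r v + \<gamma> * n v" for v
  proof -
    have "L y' v = L y v + \<gamma> * L h v" unfolding y'_def L_lin by (simp add: Ln)
    then show ?thesis unfolding L' bey' by (simp add: r_def n_def algebra_simps)
  qed
  have "inner_on V (b e') (\<lambda>v. r v + \<gamma> * n v) = 0" if e': "e' \<in> insert e E" for e'
  proof (cases "e' = e")
    case False
    then show ?thesis using e' y h by (simp add: r_def n_def inner_on_add_right inner_on_scale_right)
  next
    case True
    show ?thesis
    proof (cases "?be n = 0")
      case True
      then have "inner_on V r n = 0"
        using ben by (cases "finite V") (auto simp: inner_on_def sum_nonneg_eq_0_iff)
      then have "inner_on V r (b e) = inner_on V r (L h)" by (simp add: n_def inner_on_diff_right)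
      also have "\<dots> = 0" using orth y by (simp add: r_def)
      finally show ?thesis using True \<open>e' = e\<close>
        by (simp add: inner_on_add_right inner_on_scale_right inner_on_commute)
    next
      case False
      have "?be (\<lambda>v. r v + \<gamma> * n v) = ?be r + \<gamma> * ?be n"
        by (simp only: inner_on_add_right inner_on_scale_right)
      then show ?thesis using \<open>e' = e\<close> False by (simp add: \<gamma>_def)
    qed
  qed
  then show ?case unfolding res[symmetric] by blast
qed

section \<open>Orthonormal bases\<close>

lemma sum_fscale_apply: "(\<Sum>i\<in>I. fscale (c i) (s i)) v = (\<Sum>i\<in>I. c i * s i v)"
  by (induction I rule: infinite_finite_induct) (simp_all add: fscale_def)

text \<open>\<open>N\<close> is linear in its first argument only, because in the application the
  second one enters through chosen potentials. Linearity there comes from symmetry, which holds on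
  the span.\<close>

lemma gram_schmidt:
  fixes N :: "('v \<Rightarrow> real) \<Rightarrow> ('v \<Rightarrow> real) \<Rightarrow> real"
  assumes add: "\<And>x y z. N (x + y) z = N x z + N y z" and scale: "\<And>c x z. N (fscale c x) z = c * N x z"
    and B: "finite B" "fvec.independent B"
    and sym: "\<And>x y. x \<in> fvec.span B \<Longrightarrow> y \<in> fvec.span B \<Longrightarrow> N x y = N y x"
    and pos: "\<And>x. x \<in> fvec.span B \<Longrightarrow> x \<noteq> 0 \<Longrightarrow> 0 < N x x"
  shows "\<exists>s. (\<forall>i<card B. s i \<in> fvec.span B) \<and> (\<forall>i<card B. \<forall>j<card B. N (s i) (s j) = of_bool (i = j)) \<and>
    (\<forall>x\<in>fvec.span B. \<exists>c. x = (\<Sum>i<card B. fscale (c i) (s i)))"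
  using B sym pos
proof (induction B rule: finite_induct)
  case empty
  then show ?case by simp
next
  case (insert b B)
  let ?n = "card B"
  have sub: "fvec.span B \<subseteq> fvec.span (insert b B)" by (intro fvec.span_mono) auto
  have indep: "fvec.independent B" "b \<notin> fvec.span B"
    using insert.prems(1) insert.hyps by (auto simp: fvec.independent_insert)
  have "\<exists>s. (\<forall>i<?n. s i \<in> fvec.span B) \<and> (\<forall>i<?n. \<forall>j<?n. N (s i) (s j) = of_bool (i = j)) \<and>
    (\<forall>x\<in>fvec.span B. \<exists>c. x = (\<Sum>i<?n. fscale (c i) (s i)))"
  proof (rule insert.IH[OF indep(1)])
    show "N x y = N y x" if "x \<in> fvec.span B" "y \<in> fvec.span B" for x y
      using insert.prems(2) that sub by (meson subsetD)
    show "0 < N x x" if "x \<in> fvec.span B" "x \<noteq> 0" for x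
      using insert.prems(3) that sub by (meson subsetD)
  qed
  then obtain s where H: "(\<forall>i<?n. s i \<in> fvec.span B) \<and> (\<forall>i<?n. \<forall>j<?n. N (s i) (s j) = of_bool (i = j)) \<and>
    (\<forall>x\<in>fvec.span B. \<exists>c. x = (\<Sum>i<?n. fscale (c i) (s i)))" by (elim exE)
  have s: "\<And>i. i < ?n \<Longrightarrow> s i \<in> fvec.span B"
    "\<And>i j. i < ?n \<Longrightarrow> j < ?n \<Longrightarrow> N (s i) (s j) = of_bool (i = j)"
    using H by blast+
  have s_span: "\<exists>c. x = (\<Sum>i<?n. fscale (c i) (s i))" if "x \<in> fvec.span B" for x
    using conjunct2[OF conjunct2[OF H]] that by (rule bspec)
  have Nsum: "N (\<Sum>i\<in>K. fscale (c i) (t i)) z = (\<Sum>i\<in>K. c i * N (t i) z)" for K :: "nat set" and c t z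
    using scale[of 0 0 z] by (induction K rule: infinite_finite_induct) (simp_all add: add scale)
  define r where "r = b + fscale (- 1) (\<Sum>i<?n. fscale (N b (s i)) (s i))"
  have sum_in: "(\<Sum>i<?n. fscale (c i) (s i)) \<in> fvec.span B" for c
    using s(1) by (intro fvec.span_sum fvec.span_scale) auto
  have b_in: "b \<in> fvec.span (insert b B)" by (intro fvec.span_base) simp
  have r_in: "r \<in> fvec.span (insert b B)"
    unfolding r_def using sum_in sub b_in by (intro fvec.span_add fvec.span_scale) auto
  have b_eq: "b = r + (\<Sum>i<?n. fscale (N b (s i)) (s i))"
    by (simp add: r_def fscale_def fun_eq_iff)
  have "r \<noteq> 0"
  proof
    assume "r = 0"
    with b_eq have "b = (\<Sum>i<?n. fscale (N b (s i)) (s i))" by (simp only: add_0_left)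
    with sum_in[of "\<lambda>i. N b (s i)"] indep(2) show False by (simp only:)
  qed
  then have Nr: "N r r > 0" by (rule insert.prems(3)[OF r_in])
  have rs: "N r (s j) = 0" if j: "j < ?n" for j
  proof -
    have "N r (s j) = N b (s j) - (\<Sum>i<?n. N b (s i) * N (s i) (s j))"
      unfolding r_def add scale Nsum by simp
    also have "(\<Sum>i<?n. N b (s i) * N (s i) (s j)) = (\<Sum>i<?n. if i = j then N b (s i) else 0)"
      using j s(2) by (intro sum.cong) auto
    finally show ?thesis using j by simp
  qed
  let ?q = "1 / sqrt (N r r)"
  define s' where "s' i = (if i < ?n then s i else fscale ?q r)" for i
  have card: "card (insert b B) = Suc ?n" using insert.hyps by simp
  have s'_in: "s' i \<in> fvec.span (insert b B)" for i
    using s(1) sub r_in by (auto simp: s'_def intro: fvec.span_scale)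
  have "N (s' i) (s' j) = of_bool (i = j)" if ij: "i < Suc ?n" "j < Suc ?n" for i j
  proof -
    have rr: "N (fscale ?q r) (fscale ?q r) = 1"
    proof -
      have "N (fscale ?q r) (fscale ?q r) = ?q * N r (fscale ?q r)" by (rule scale)
      also have "N r (fscale ?q r) = N (fscale ?q r) r"
        by (intro insert.prems(2) fvec.span_scale r_in)
      also have "\<dots> = ?q * N r r" by (rule scale)
      finally show ?thesis using Nr by simp
    qed
    have sr: "N (s k) (fscale ?q r) = 0" if "k < ?n" for k
    proof -
      have "N (s k) (fscale ?q r) = N (fscale ?q r) (s k)"
        using s(1)[OF that] sub r_in by (intro insert.prems(2) fvec.span_scale) auto
      then show ?thesis using rs[OF that] by (simp add: scale)
    qed
    show ?thesis using ij s(2) rs sr rr by (auto simp: s'_def scale less_Suc_eq)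
  qed
  moreover have "\<exists>c. x = (\<Sum>i<Suc ?n. fscale (c i) (s' i))" if x: "x \<in> fvec.span (insert b B)" for x
  proof -
    obtain k where k: "x - fscale k b \<in> fvec.span B" using fvec.span_breakdown_eq x by blast
    then obtain c where c: "x - fscale k b = (\<Sum>i<?n. fscale (c i) (s i))" using s_span[OF k] by (elim exE)
    define c' where "c' i = (if i < ?n then c i + k * N b (s i) else k * sqrt (N r r))" for i
    have "x v = (\<Sum>i<Suc ?n. fscale (c' i) (s' i)) v" for v
    proof -
      have "x v = k * b v + (\<Sum>i<?n. c i * s i v)"
        using fun_cong[OF c, of v] unfolding sum_fscale_apply by (simp add: fscale_def)
      also have "b v = r v + (\<Sum>i<?n. N b (s i) * s i v)"
        using fun_cong[OF b_eq, of v] unfolding plus_fun_apply sum_fscale_apply .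
      also have "k * (r v + (\<Sum>i<?n. N b (s i) * s i v)) + (\<Sum>i<?n. c i * s i v) =
        (\<Sum>i<?n. c' i * s' i v) + c' ?n * s' ?n v"
        using Nr by (simp add: c'_def s'_def fscale_def algebra_simps sum.distrib sum_distrib_left)
      finally show ?thesis unfolding sum_fscale_apply by simp
    qed
    then show ?thesis by blast
  qed
  ultimately show ?case unfolding card using s'_in by blast
qed

lemma orthonormal_basis_exists:
  fixes N :: "('v \<Rightarrow> real) \<Rightarrow> ('v \<Rightarrow> real) \<Rightarrow> real"
  assumes V: "finite V" and S: "fvec.subspace S" "S \<subseteq> vecs V"
    and add: "\<And>x y z. N (x + y) z = N x z + N y z" and scale: "\<And>c x z. N (fscale c x) z = c * N x z"
    and sym: "\<And>x y. x \<in> S \<Longrightarrow> y \<in> S \<Longrightarrow> N x y = N y x"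
    and pos: "\<And>x. x \<in> S \<Longrightarrow> x \<noteq> 0 \<Longrightarrow> 0 < N x x"
  shows "\<exists>s. (\<forall>i<fvec.dim S. s i \<in> S) \<and>
    (\<forall>i<fvec.dim S. \<forall>j<fvec.dim S. N (s i) (s j) = of_bool (i = j)) \<and>
    (\<forall>x\<in>S. \<exists>c. x = (\<Sum>i<fvec.dim S. fscale (c i) (s i)))"
proof -
  obtain B where B: "B \<subseteq> S" "fvec.independent B" "S \<subseteq> fvec.span B" "card B = fvec.dim S"
    using fvec.basis_exists by blast
  \<comment> \<open>The indicators of the points of \<open>V\<close> span \<open>vecs V\<close>,
    which makes the basis \<open>B\<close> finite.\<close>
  let ?u = "\<lambda>v w. of_bool (w = v) :: real"
  have "x \<in> fvec.span (?u ` V)" if "x \<in> vecs V" for x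
  proof -
    have "x = (\<Sum>v\<in>V. fscale (x v) (?u v))"
    proof
      fix w
      have "(\<Sum>v\<in>V. x v * ?u v w) = (\<Sum>v\<in>V. if v = w then x v else 0)" by (intro sum.cong) auto
      then show "x w = (\<Sum>v\<in>V. fscale (x v) (?u v)) w"
        using that V unfolding sum_fscale_apply by (auto simp: vecs_def)
    qed
    moreover have "(\<Sum>v\<in>V. fscale (x v) (?u v)) \<in> fvec.span (?u ` V)"
      by (intro fvec.span_sum fvec.span_scale fvec.span_base) auto
    ultimately show ?thesis by simp
  qed
  then have "B \<subseteq> fvec.span (?u ` V)" using B(1) S(2) by blast
  then have finB: "finite B"
    using fvec.independent_span_bound[of "?u ` V" B] V B(2) by blast
  have span: "fvec.span B = S"
    using B S(1) by (simp add: fvec.span_minimal subset_antisym)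
  have "\<exists>s. (\<forall>i<card B. s i \<in> fvec.span B) \<and> (\<forall>i<card B. \<forall>j<card B. N (s i) (s j) = of_bool (i = j)) \<and>
    (\<forall>x\<in>fvec.span B. \<exists>c. x = (\<Sum>i<card B. fscale (c i) (s i)))"
    by (rule gram_schmidt[of N, OF add scale finB B(2)]) (use sym pos span in blast)+
  then show ?thesis unfolding span B(4) .
qed

section \<open>The minor of a network\<close>

lemma reachable_mk_symmetric_induct [consumes 1, case_names refl edge]:
  assumes "u \<rightarrow>\<^sup>*\<^bsub>with_proj (mk_symmetric (G\<lparr>arcs := C\<rparr>))\<^esub> v" and "P u"
    and "\<And>e. e \<in> C \<Longrightarrow> P (tail G e) \<longleftrightarrow> P (head G e)"
  shows "P v"
  using assms(1) unfolding reachable_def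
  by (induction rule: rtrancl_on_induct) (use assms(2,3) in \<open>auto simp: parcs_mk_symmetric\<close>)

text \<open>Split \<open>x\<close> into \<open>L y\<close> and a residual without drop on any edge;
  the factors \<open>sqrt (w e)\<close> turn the sum of squares into the weighted Laplacian.
  Connectedness makes the residual constant, and its sum 0 makes it vanish.\<close>

lemma (in fin_digraph) laplacian_solvable:
  assumes conn: "Digraph_Component.connected G" and w: "\<And>e. e \<in> arcs G \<Longrightarrow> 0 < w e"
    and x: "(\<Sum>v\<in>verts G. x v) = 0"
  shows "\<exists>y. \<forall>v\<in>verts G. (\<Sum>e\<in>arcs G. incidence G e v * (w e * potential_drop G y e)) = x v"
proof -
  let ?b = "\<lambda>e v. sqrt (w e) * incidence G e v"
  have b: "inner_on (verts G) (?b e) y = sqrt (w e) * potential_drop G y e" if "e \<in> arcs G" for e y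
    using that by (simp add: inner_on_scale_left inner_on_incidence)
  define L where "L y v = (\<Sum>e\<in>arcs G. incidence G e v * (w e * potential_drop G y e))" for y v
  have L: "(\<Sum>e\<in>arcs G. ?b e v * inner_on (verts G) (?b e) y) = L y v" for y v
    unfolding L_def
  proof (intro sum.cong refl)
    fix e assume e: "e \<in> arcs G"
    then have "w e = sqrt (w e) * sqrt (w e)" using w by (simp add: less_imp_le)
    then show "?b e v * inner_on (verts G) (?b e) y = incidence G e v * (w e * potential_drop G y e)"
      unfolding b[OF e] by (metis mult.assoc mult.left_commute)
  qed
  obtain y where y: "\<forall>e\<in>arcs G. inner_on (verts G) (?b e) (\<lambda>v. x v - L y v) = 0"
    using range_kernel_decomposition[of "arcs G" "verts G" ?b x] unfolding L by auto
  define r where "r = (\<lambda>v. x v - L y v)"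
  have "potential_drop G r e = 0" if "e \<in> arcs G" for e
  proof -
    have "sqrt (w e) * potential_drop G r e = 0"
      using y that unfolding b[OF that, symmetric] r_def by blast
    then show ?thesis using w[OF that] by simp
  qed
  then have r_edge: "r (tail G e) = r (head G e)" if "e \<in> arcs G" for e
    using that by (simp add: potential_drop_def)
  obtain u where u: "u \<in> verts G"
    using conn by (auto simp: connected_def strongly_connected_def)
  have r_const: "r v = r u" if "v \<in> verts G" for v
  proof -
    have "u \<rightarrow>\<^sup>*\<^bsub>with_proj (mk_symmetric G)\<^esub> v"
      using conn u that by (auto simp: connected_def strongly_connected_def)
    moreover have "G\<lparr>arcs := arcs G\<rparr> = G" by simp
    ultimately have "u \<rightarrow>\<^sup>*\<^bsub>with_proj (mk_symmetric (G\<lparr>arcs := arcs G\<rparr>))\<^esub> v" by simp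
    then show ?thesis by (induction rule: reachable_mk_symmetric_induct) (simp_all add: r_edge)
  qed
  have "(\<Sum>v\<in>verts G. L y v) = (\<Sum>e\<in>arcs G. (\<Sum>v\<in>verts G. incidence G e v) * (w e * potential_drop G y e))"
    unfolding L_def sum_distrib_right by (rule sum.swap)
  also have "\<dots> = 0" by (simp add: sum_incidence)
  finally have "(\<Sum>v\<in>verts G. r v) = 0" using x by (simp add: r_def sum_subtractf)
  then have "real (card (verts G)) * r u = 0" using r_const by simp
  then have "r u = 0" using u finite_verts by auto
  then show ?thesis using r_const unfolding r_def L_def by (intro exI[of _ y]) auto
qed

lemma (in fin_digraph) network_full:
  assumes "Digraph_Component.connected G" and "\<And>e. e \<in> arcs G \<Longrightarrow> 0 < w e"
  shows "network G (arcs G) {} w"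
  unfolding network_def
proof (intro conjI allI impI)
  fix x :: "'a \<Rightarrow> real" assume "(\<Sum>v\<in>verts G. x v) = 0"
  then obtain y where "\<forall>v\<in>verts G. (\<Sum>e\<in>arcs G. incidence G e v * (w e * potential_drop G y e)) = x v"
    using laplacian_solvable[where w = w and x = x] assms by blast
  then show "\<exists>y f. elec G (arcs G) {} w x y f"
    by (intro exI[of _ y] exI[of _ "\<lambda>e. w e * potential_drop G y e"]) (simp add: elec_def)
qed (use assms in auto)

text \<open>Equivalent vertices reach the same vertices, so the choice gives them the same
  representative; the minor then lives on vertices of the given graph.\<close>

definition contraction_rep :: "('v, 'e) pre_digraph \<Rightarrow> 'e set \<Rightarrow> 'v \<Rightarrow> 'v" where
  "contraction_rep G C v = (SOME u. v \<rightarrow>\<^sup>*\<^bsub>with_proj (mk_symmetric (G\<lparr>arcs := C\<rparr>))\<^esub> u)"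

definition network_minor :: "('v, 'e) pre_digraph \<Rightarrow> 'e set \<Rightarrow> 'e set \<Rightarrow> ('v, 'e) pre_digraph" where
  "network_minor G R C = \<lparr>verts = contraction_rep G C ` verts G, arcs = R,
     tail = contraction_rep G C \<circ> tail G, head = contraction_rep G C \<circ> head G\<rparr>"

section \<open>The energy form of the minor\<close>

context fin_digraph
begin

context
  fixes R C :: "'b set" and w :: "'b \<Rightarrow> real"
  assumes net: "network G R C w"
begin

abbreviation (input) \<phi> where "\<phi> \<equiv> contraction_rep G C"
abbreviation (input) H where "H \<equiv> network_minor G R C"
abbreviation (input) sim where "sim u v \<equiv> u \<rightarrow>\<^sup>*\<^bsub>with_proj (mk_symmetric (G\<lparr>arcs := C\<rparr>))\<^esub> v"

lemma network_arcs: "R \<subseteq> arcs G" "C \<subseteq> arcs G" "R \<inter> C = {}" and network_weight_pos: "e \<in> R \<Longrightarrow> 0 < w e"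
  using net by (auto simp: network_def)

lemma wf_contracted: "wf_digraph (with_proj (mk_symmetric (G\<lparr>arcs := C\<rparr>)))"
  by unfold_locales (use network_arcs in \<open>auto simp: parcs_mk_symmetric\<close>)

lemma sim_refl: "v \<in> verts G \<Longrightarrow> sim v v"
  by (simp add: reachable_def)

lemma sim_sym: "sim u v \<Longrightarrow> sim v u"
  by (rule symmetric_reachable[OF symmetric_mk_symmetric])

lemma sim_trans: "sim u v \<Longrightarrow> sim v z \<Longrightarrow> sim u z"
  unfolding reachable_def by (rule rtrancl_on_trans)

lemma rep_sim: "v \<in> verts G \<Longrightarrow> sim v (\<phi> v)"
  unfolding contraction_rep_def using sim_refl by (rule someI)

lemma rep_in_verts: "v \<in> verts G \<Longrightarrow> \<phi> v \<in> verts G"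
  using rep_sim unfolding reachable_def by (auto dest: in_rtrancl_on_in_F)

lemma rep_eq_iff: "u \<in> verts G \<Longrightarrow> v \<in> verts G \<Longrightarrow> \<phi> u = \<phi> v \<longleftrightarrow> sim u v"
proof
  show "sim u v" if "u \<in> verts G" "v \<in> verts G" "\<phi> u = \<phi> v"
    using rep_sim[OF that(1)] rep_sim[OF that(2)] that(3) by (metis sim_sym sim_trans)
  show "\<phi> u = \<phi> v" if "sim u v"
  proof -
    have "sim u = sim v" 
      using sim_trans[OF that] sim_trans[OF sim_sym[OF that]] by (intro ext iffI)
    then show ?thesis by (simp add: contraction_rep_def)
  qed
qed

lemma rep_rep: "v \<in> verts G \<Longrightarrow> \<phi> (\<phi> v) = \<phi> v"
  using rep_eq_iff rep_in_verts rep_sim sim_sym by metis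

lemma rep_contracted:
  assumes "e \<in> C" shows "\<phi> (tail G e) = \<phi> (head G e)"
proof -
  have "(tail G e, head G e) \<in> parcs (mk_symmetric (G\<lparr>arcs := C\<rparr>))"
    using assms by (auto simp: parcs_mk_symmetric)
  then have "sim (tail G e) (head G e)"
    using assms network_arcs by (intro wf_digraph.reachable_adjI[OF wf_contracted]) simp
  then show ?thesis using assms network_arcs rep_eq_iff by auto
qed

lemma reweighted_minor_network: "reweighted_minor G H w \<phi>"
  unfolding reweighted_minor_def
  by (intro conjI exI[of _ C] exI[of _ "arcs G - R - C"])
    (use network_arcs network_weight_pos rep_eq_iff in \<open>auto simp: network_minor_def\<close>)

lemma fin_digraph_minor: "fin_digraph H"
  by unfold_locales (use network_arcs finite_subset[OF network_arcs(1)] in \<open>auto simp: network_minor_def\<close>)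

lemma elec_rep:
  assumes "elec G R C w x y f" "v \<in> verts G" shows "y (\<phi> v) = y v"
  using rep_sim[OF assms(2)]
  by (induction rule: reachable_mk_symmetric_induct) (use assms in \<open>auto simp: elec_def potential_drop_def\<close>)

lemma incidence_minor: "incidence H e u = potential_drop G (contraction_mat \<phi> u) e"
  by (simp add: incidence_def network_minor_def potential_drop_def contraction_mat_def)

text \<open>Pair the flow with the indicator of the class of \<open>u\<close>: contracted edges stay
  within a class, deleted ones carry no flow, and \<open>y\<close>, being constant on classes,
  serves as a potential on the minor.\<close>

lemma minor_flow:
  assumes el: "elec G R C w x y f"
  shows "(\<Sum>e\<in>arcs H. incidence H e u * (w e * potential_drop H y e)) =
    mat_vec (verts G) (contraction_mat \<phi>) x u"
proof -
  have "mat_vec (verts G) (contraction_mat \<phi>) x u = inner_on (verts G) x (contraction_mat \<phi> u)"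
    by (simp add: mat_vec_def inner_on_def mult.commute)
  also have "\<dots> = (\<Sum>e\<in>arcs G. f e * potential_drop G (contraction_mat \<phi> u) e)"
    using el by (intro inner_on_flow) (simp add: elec_def)
  also have "\<dots> = (\<Sum>e\<in>R. f e * potential_drop G (contraction_mat \<phi> u) e)"
  proof (intro sum.mono_neutral_right ballI)
    fix e assume e: "e \<in> arcs G - R"
    show "f e * potential_drop G (contraction_mat \<phi> u) e = 0"
      using e el rep_contracted[of e] by (cases "e \<in> C")
        (simp_all add: elec_def potential_drop_def contraction_mat_def)
  qed (use network_arcs in auto)
  also have "\<dots> = (\<Sum>e\<in>R. incidence H e u * (w e * potential_drop H y e))"
  proof (intro sum.cong refl)
    fix e assume e: "e \<in> R"
    then have "f e = w e * potential_drop G y e" using el by (simp add: elec_def)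
    moreover have "potential_drop H y e = potential_drop G y e"
      using e network_arcs elec_rep[OF el] by (auto simp: potential_drop_def network_minor_def)
    ultimately show "f e * potential_drop G (contraction_mat \<phi> u) e = incidence H e u * (w e * potential_drop H y e)"
      by (simp add: incidence_minor)
  qed
  finally show ?thesis by (simp add: network_minor_def)
qed

lemma quad_form_minor:
  assumes ne: "verts G \<noteq> {}" and el: "elec G R C w x y f"
  shows "quad_form (verts H) (laplacian_pinv H w) (mat_vec (verts G) (contraction_mat \<phi>) x) =
    inner_on (verts G) x y"
proof -
  interpret Hd: fin_digraph H by (rule fin_digraph_minor)
  have vH: "verts H = \<phi> ` verts G" by (simp add: network_minor_def)
  have vH_sub: "verts H \<subseteq> verts G" using rep_in_verts by (auto simp: vH)
  have "quad_form (verts H) (laplacian_pinv H w) (mat_vec (verts G) (contraction_mat \<phi>) x) =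
    inner_on (verts H) (mat_vec (verts G) (contraction_mat \<phi>) x) y"
  proof (rule Hd.quad_form_laplacian_pinv)
    show "verts H \<noteq> {}" using ne by (simp add: vH)
    fix z :: "'a \<Rightarrow> real" assume z: "(\<Sum>u\<in>verts H. z u) = 0"
    \<comment> \<open>A demand of the minor is extended by 0 to the given graph; representatives are
      fixed by the contraction map, so its projection is the demand itself.\<close>
    define z' where "z' v = (if v \<in> verts H then z v else 0)" for v
    have "(\<Sum>v\<in>verts G. z' v) = 0"
      using z vH_sub finite_verts sum.mono_neutral_right[of "verts G" "verts H" z']
      by (simp add: z'_def)
    then obtain y' f' where el': "elec G R C w z' y' f'" using net by (auto simp: network_def)
    have "mat_vec (verts G) (contraction_mat \<phi>) z' u = z u" if u: "u \<in> verts H" for u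
    proof -
      have rep: "\<phi> v = v" if "v \<in> verts H" for v using that rep_rep by (auto simp: vH)
      have "mat_vec (verts G) (contraction_mat \<phi>) z' u = (\<Sum>v\<in>verts G. if v = u then z u else 0)"
        unfolding mat_vec_def contraction_mat_def using u rep by (intro sum.cong refl) (auto simp: z'_def)
      then show ?thesis using u vH_sub by auto
    qed
    then show "\<exists>y. \<forall>v\<in>verts H. (\<Sum>e\<in>arcs H. incidence H e v * (w e * potential_drop H y e)) = z v"
      unfolding minor_flow[OF el', symmetric] using minor_flow[OF el'] by metis
  qed (rule minor_flow[OF el])
  also have "\<dots> = (\<Sum>u\<in>verts H. \<Sum>v\<in>verts G. (if u = \<phi> v then x v * y u else 0))"
    unfolding inner_on_def mat_vec_def contraction_mat_def sum_distrib_right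
    by (intro sum.cong refl) auto
  also have "\<dots> = (\<Sum>v\<in>verts G. \<Sum>u\<in>verts H. (if u = \<phi> v then x v * y u else 0))"
    by (rule sum.swap)
  also have "\<dots> = (\<Sum>v\<in>verts G. x v * y v)"
    using elec_rep[OF el] Hd.finite_verts by (intro sum.cong refl) (auto simp: vH)
  finally show ?thesis by (simp add: inner_on_def)
qed

end

text \<open>Reciprocity moves everything to the potentials \<open>Y i\<close>, which avoids
  identifying \<open>y\<close> with a combination of them.\<close>

lemma realizes_quad_form:
  assumes M: "realizes G I s R C w M" and x: "\<And>v. v \<in> verts G \<Longrightarrow> x v = (\<Sum>i\<in>I. c i * s i v)"
    and el: "elec G R C w x y f"
  shows "inner_on (verts G) x y = quad_form I M c"
proof -
  have net: "network G R C w" using M by (simp add: realizes_def)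
  note RC = network_arcs[OF net]
  obtain Y F where Y: "\<And>i. i \<in> I \<Longrightarrow> elec G R C w (s i) (Y i) (F i)"
      and MY: "\<And>i j. i \<in> I \<Longrightarrow> j \<in> I \<Longrightarrow> M j i = inner_on (verts G) (s j) (Y i)"
    using M by (auto simp: realizes_def)
  have comb: "inner_on (verts G) x z = (\<Sum>i\<in>I. c i * inner_on (verts G) (s i) z)" for z
  proof -
    have "inner_on (verts G) x z = (\<Sum>v\<in>verts G. \<Sum>i\<in>I. c i * (s i v * z v))"
      unfolding inner_on_def using x by (intro sum.cong refl) (simp add: sum_distrib_right mult.assoc)
    then show ?thesis by (subst (asm) sum.swap) (simp add: inner_on_def sum_distrib_left)
  qed
  have "inner_on (verts G) x y = (\<Sum>i\<in>I. c i * inner_on (verts G) (s i) y)" by (rule comb)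
  also have "\<dots> = (\<Sum>i\<in>I. c i * (\<Sum>j\<in>I. M j i * c j))"
  proof (intro sum.cong refl)
    fix i assume i: "i \<in> I"
    have "inner_on (verts G) (s i) y = inner_on (verts G) x (Y i)"
      by (rule elec_reciprocity[OF Y[OF i] el RC])
    also have "\<dots> = (\<Sum>j\<in>I. M j i * c j)"
      unfolding comb using MY i by (intro sum.cong refl) (simp add: mult.commute)
    finally show "c i * inner_on (verts G) (s i) y = c i * (\<Sum>j\<in>I. M j i * c j)" by simp
  qed
  also have "\<dots> = (\<Sum>i\<in>I. \<Sum>j\<in>I. M j i * c j * c i)"
    by (simp add: sum_distrib_left mult_ac)
  also have "\<dots> = quad_form I M c"
    unfolding quad_form_def inner_on_mat_vec by (rule sum.swap)
  finally show ?thesis .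
qed

lemma realizes_orthonormal:
  assumes conn: "Digraph_Component.connected G" and w: "\<And>e. e \<in> arcs G \<Longrightarrow> 0 < w e"
    and S: "fvec.subspace S" "S \<subseteq> vecs (verts G)" "\<And>x. x \<in> S \<Longrightarrow> (\<Sum>v\<in>verts G. x v) = 0"
  shows "\<exists>s. realizes G {..<fvec.dim S} s (arcs G) {} w (scalar_mat 1) \<and>
    (\<forall>x\<in>S. \<exists>c. x = (\<Sum>i<fvec.dim S. fscale (c i) (s i)))"
proof -
  let ?el = "elec G (arcs G) {} w"
  have net: "network G (arcs G) {} w" using conn w by (rule network_full)
  have "\<exists>y f. ?el x y f" if "x \<in> S" for x
    using net S(3)[OF that] by (auto simp: network_def)
  then obtain y f where y: "\<And>x. x \<in> S \<Longrightarrow> ?el x (y x) (f x)" by metis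
  define N where "N x z = inner_on (verts G) x (y z)" for x z
  have "\<exists>s. (\<forall>i<fvec.dim S. s i \<in> S) \<and>
    (\<forall>i<fvec.dim S. \<forall>j<fvec.dim S. N (s i) (s j) = of_bool (i = j)) \<and>
    (\<forall>x\<in>S. \<exists>c. x = (\<Sum>i<fvec.dim S. fscale (c i) (s i)))"
  proof (rule orthonormal_basis_exists[OF finite_verts S(1,2)])
    show "N (x + x') z = N x z + N x' z" for x x' z
      unfolding N_def plus_fun_def by (rule inner_on_add_left)
    show "N (fscale c x) z = c * N x z" for c x z
      unfolding N_def fscale_def by (rule inner_on_scale_left)
    show "N x z = N z x" if "x \<in> S" "z \<in> S" for x z
      unfolding N_def using y that by (intro elec_reciprocity) auto
    show "0 < N x x" if x: "x \<in> S" "x \<noteq> 0" for x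
    proof -
      have N: "N x x = (\<Sum>e\<in>arcs G. w e * potential_drop G (y x) e * potential_drop G (y x) e)"
        unfolding N_def using y[OF x(1)] by (intro elec_inner_on) auto
      have pos: "0 \<le> w e * potential_drop G (y x) e * potential_drop G (y x) e" if "e \<in> arcs G" for e
        using w[OF that] by (simp add: mult.assoc)
      \<comment> \<open>Zero energy means no current on any edge, hence zero demand.\<close>
      have "N x x \<noteq> 0"
      proof
        assume "N x x = 0"
        then have "\<forall>e\<in>arcs G. w e * potential_drop G (y x) e * potential_drop G (y x) e = 0"
          unfolding N using pos by (subst (asm) sum_nonneg_eq_0_iff) auto
        then have "f x e = 0" if "e \<in> arcs G" for e
          using y[OF x(1)] that w[OF that] by (auto simp: elec_def)
        then have "x v = 0" if "v \<in> verts G" for v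
          using y[OF x(1)] that by (auto simp: elec_def)
        then have "x v = 0" for v using x(1) S(2) by (cases "v \<in> verts G") (auto simp: vecs_def)
        then show False using x(2) by auto
      qed
      then show ?thesis unfolding N using sum_nonneg pos by (metis (no_types, lifting) N less_eq_real_def)
    qed
  qed
  then obtain s where s: "\<forall>i<fvec.dim S. s i \<in> S"
    "\<forall>i<fvec.dim S. \<forall>j<fvec.dim S. N (s i) (s j) = of_bool (i = j)"
    "\<forall>x\<in>S. \<exists>c. x = (\<Sum>i<fvec.dim S. fscale (c i) (s i))" by (elim exE conjE)
  have "realizes G {..<fvec.dim S} s (arcs G) {} w (scalar_mat 1)"
    unfolding realizes_def using net y s(1,2)
    by (intro conjI exI[of _ "\<lambda>i. y (s i)"] exI[of _ "\<lambda>i. f (s i)"]) (auto simp: N_def scalar_mat_def)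
  then show ?thesis using s(3) by (intro exI conjI)
qed

lemma sparsifier_exists:
  assumes conn: "Digraph_Component.connected G" and w: "\<And>e. e \<in> arcs G \<Longrightarrow> 0 < w e"
    and S: "fvec.subspace S" "S \<subseteq> vecs (verts G)" "\<And>x. x \<in> S \<Longrightarrow> (\<Sum>v\<in>verts G. x v) = 0"
    and \<epsilon>: "0 < \<epsilon>" "\<epsilon> < 1"
  shows "\<exists>(H :: ('a, 'b) pre_digraph) wH \<phi>. spectral_subspace_sparsifier G w S \<epsilon> H wH \<phi> \<and>
    real (card (arcs H)) \<le> 3201 * real (fvec.dim S) / \<epsilon>\<^sup>2"
proof -
  let ?I = "{..<fvec.dim S}"
  have "\<exists>s. realizes G ?I s (arcs G) {} w (scalar_mat 1) \<and>
    (\<forall>x\<in>S. \<exists>c. x = (\<Sum>i<fvec.dim S. fscale (c i) (s i)))"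
    by (rule realizes_orthonormal[OF conn _ S(1,2)]; fact w S(3))
  then obtain s where s: "realizes G ?I s (arcs G) {} w (scalar_mat 1)"
    and span: "\<forall>x\<in>S. \<exists>c. x = (\<Sum>i<fvec.dim S. fscale (c i) (s i))"
    by (elim exE conjE)
  define P where "P = (\<lambda>m M. \<exists>R C w. card R = m \<and> realizes G ?I s R C w M)"
  have step: "\<exists>(E :: 'b set) v. card E = m \<and> removal_step ?I P E v M" if PmM: "P m M" for m M
  proof -
    obtain R C w where R: "card R = m" "realizes G ?I s R C w M" using PmM by (auto simp: P_def)
    obtain v where "removal_step ?I P R v M"
      using realizes_removal_step[OF R(2), folded P_def] by (elim exE)
    with R(1) show ?thesis by blast
  qed
  have "P (card (arcs G)) (scalar_mat 1)" using s by (auto simp: P_def)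
  from barrier_process[OF step finite_lessThan \<epsilon> this]
  obtain k M where k: "P k M" "real k \<le> 3201 * card ?I / \<epsilon>\<^sup>2"
    and M: "\<And>c. (1 - \<epsilon>) * inner_on ?I c c \<le> quad_form ?I M c"
      "\<And>c. quad_form ?I M c \<le> (1 + \<epsilon>) * inner_on ?I c c" by blast
  obtain R C wH where R: "card R = k" "realizes G ?I s R C wH M" using k(1) by (auto simp: P_def)
  have netG: "network G (arcs G) {} w" and netH: "network G R C wH"
    using s R by (auto simp: realizes_def)
  have ne: "verts G \<noteq> {}" using conn by (auto simp: connected_def strongly_connected_def)
  let ?\<phi> = "contraction_rep G C" and ?H = "network_minor G R C"
  have "(1 - \<epsilon>) * quad_form (verts G) (laplacian_pinv G w) x
      \<le> quad_form (verts ?H) (laplacian_pinv ?H wH) (mat_vec (verts G) (contraction_mat ?\<phi>) x) \<and>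
    quad_form (verts ?H) (laplacian_pinv ?H wH) (mat_vec (verts G) (contraction_mat ?\<phi>) x)
      \<le> (1 + \<epsilon>) * quad_form (verts G) (laplacian_pinv G w) x" if x: "x \<in> S" for x
  proof -
    have "\<exists>c. x = (\<Sum>i<fvec.dim S. fscale (c i) (s i))" using span x by (rule bspec)
    then obtain c where "x = (\<Sum>i<fvec.dim S. fscale (c i) (s i))" by (elim exE)
    then have c: "x v = (\<Sum>i\<in>?I. c i * s i v)" for v by (simp add: sum_fscale_apply)
    obtain y f where el: "elec G (arcs G) {} w x y f" using netG S(3)[OF x] by (auto simp: network_def)
    obtain y' f' where el': "elec G R C wH x y' f'" using netH S(3)[OF x] by (auto simp: network_def)
    have "quad_form (verts G) (laplacian_pinv G w) x = inner_on (verts G) x y"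
      using el by (intro quad_form_laplacian_pinv[OF ne laplacian_solvable[where w = w, OF conn w]]) (auto simp: elec_def)
    also have "\<dots> = quad_form ?I (scalar_mat 1) c" by (rule realizes_quad_form[OF s c el])
    also have "\<dots> = inner_on ?I c c" by (simp add: quad_form_scalar_mat)
    finally have G: "quad_form (verts G) (laplacian_pinv G w) x = inner_on ?I c c" .
    have "quad_form (verts ?H) (laplacian_pinv ?H wH) (mat_vec (verts G) (contraction_mat ?\<phi>) x) =
      quad_form ?I M c"
      unfolding quad_form_minor[OF netH ne el'] by (rule realizes_quad_form[OF R(2) c el'])
    then show ?thesis unfolding G using M by simp
  qed
  then have "spectral_subspace_sparsifier G w S \<epsilon> ?H wH ?\<phi>"
    unfolding spectral_subspace_sparsifier_def Let_def
    using reweighted_minor_network[OF netH] by blast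
  moreover have "real (card (arcs ?H)) \<le> 3201 * real (fvec.dim S) / \<epsilon>\<^sup>2"
    using k(2) R(1) by (simp add: network_minor_def)
  ultimately show ?thesis by blast
qed

end

theorem theorem1p2:
  shows "\<exists>C::real. C > 0 \<and>
    (\<forall>(G :: ('v, 'e) pre_digraph) (w :: 'e weight_fun) (S :: ('v \<Rightarrow> real) set) (d :: nat) (\<epsilon> :: real).
       weighted_graph G w \<longrightarrow> Digraph_Component.connected G \<longrightarrow>
       fvec.subspace S \<longrightarrow> S \<subseteq> vecs (verts G) \<longrightarrow> fvec.dim S = d \<longrightarrow>
       (\<forall>x\<in>S. inner_on (verts G) x (\<lambda>_. 1) = 0) \<longrightarrow>
       0 < \<epsilon> \<longrightarrow> \<epsilon> < 1 \<longrightarrow>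
       (\<exists>(H :: ('v, 'e) pre_digraph) (wH :: 'e weight_fun) (\<phi> :: 'v \<Rightarrow> 'v).
          spectral_subspace_sparsifier G w S \<epsilon> H wH \<phi> \<and>
          real (card (arcs H)) \<le> C * (real d * max 1 (ln (real d))) / \<epsilon>\<^sup>2))"
proof (intro exI[of _ 3201] conjI allI impI)
  fix G :: "('v, 'e) pre_digraph" and w S d and \<epsilon> :: real
  assume G: "weighted_graph G w" and conn: "Digraph_Component.connected G"
    and S: "fvec.subspace S" "S \<subseteq> vecs (verts G)" and d: "fvec.dim S = d"
    and orth: "\<forall>x\<in>S. inner_on (verts G) x (\<lambda>_. 1) = 0" and \<epsilon>: "0 < \<epsilon>" "\<epsilon> < 1"
  interpret fin_digraph G using G by (simp add: weighted_graph_def)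
  obtain H :: "('v, 'e) pre_digraph" and wH \<phi> where "spectral_subspace_sparsifier G w S \<epsilon> H wH \<phi>"
    and le: "real (card (arcs H)) \<le> 3201 * real d / \<epsilon>\<^sup>2"
    using sparsifier_exists[OF conn _ S _ \<epsilon>, of w] G orth
    by (auto simp: weighted_graph_def inner_on_def d)
  \<comment> \<open>The bound is already linear in \<open>d\<close>; the maximum keeps the
    logarithmic factor at least 1.\<close>
  moreover have "3201 * real d / \<epsilon>\<^sup>2 \<le> 3201 * (real d * max 1 (ln (real d))) / \<epsilon>\<^sup>2"
    by (intro divide_right_mono) (simp_all add: mult_le_cancel_left1)
  ultimately show "\<exists>(H :: ('v, 'e) pre_digraph) (wH :: 'e weight_fun) (\<phi> :: 'v \<Rightarrow> 'v).
      spectral_subspace_sparsifier G w S \<epsilon> H wH \<phi> \<and>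
      real (card (arcs H)) \<le> 3201 * (real d * max 1 (ln (real d))) / \<epsilon>\<^sup>2"
    by (meson order_trans)
qed simp

end
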